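(* For any $t_0>0$, integers $J\ge0$ and $K_1\ge N$, and all $x\in\mathbb Z$ and $t\ge t_0$, the first discrete Green function $\mathbf u$ satisfies $$\frac{d^J\mathbf u(x,t)}{dt^J}=\frac{1}{t^J\sqrt t}\,h_{J0}\!\left(\frac{x}{\sqrt t}\right)+\sum_{n=N}^{K_1}\frac{1}{t^{n+J}\sqrt t}\,h_{Jn}\!\left(\frac{x}{\sqrt t}\right)+\mathbf r_{\mathbf u}(J,K_1;x,t),$$ where $$h_{J0}(x)=\frac{d^{2J}h(x)}{dx^{2J}},\qquad h_{Jn}(x)=\mathcal R_{Jn}\!\left(-i\frac{d}{dx}\right)h(x),$$ $$|\mathbf r_{\mathbf u}(J,K_1;x,t)|\le\frac{R_{\mathbf u}(J,K_1,t_0)}{t^{J+K_1+1}\sqrt t},$$ and $R_{\mathbf u}(J,K_1,t_0)\ge0$ does not depend on $t\ge t_0$ and $x\in\mathbb Z$.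
   Context: Fix $N\in\mathbb N$. Let $a_1,\dots,a_N\in\mathbb R$ be the unique solution of $\sum_{\nu=1}^Na_\nu\nu^2=1$, $\sum_{\nu=1}^Na_\nu\nu^{2m}=0$ for $m=2,\dots,N$. For functions $\mathbf u$ on $\mathbb Z$ let $\boldsymbol\Delta_1\mathbf u(x)=\sum_{\nu=1}^Na_\nu(\mathbf u(x-\nu)-2\mathbf u(x)+\mathbf u(x+\nu))$, and let $A(\theta)=2\sum_{\nu=1}^Na_\nu(1-\cos\nu\theta)$ be the symbol of $-\boldsymbol\Delta_1$. First discrete Green function: $\mathbf u(x,t)$, $x\in\mathbb Z$, $t\ge0$, is the function that is rapidly decreasing in $x$, $C^1$ in $t\in[0,\infty)$, and satisfies $\dot{\mathbf u}-\boldsymbol\Delta_1\mathbf u=0$ for $t>0$, $\mathbf u(0,0)=1$, $\mathbf u(x,0)=0$ for $x\ne0$. It is given by $\mathbf u(x,t)=\frac1{2\pi}\int_{-\pi}^\pi e^{-tA(\theta)}e^{ix\theta}\,d\theta$. Let $h(y)=\frac{1}{2\sqrt\pi}e^{-y^2/4}$. For integer $J\ge0$ and $n\ge N$ (empty sums are zero) set $$b_n=\frac{2(-1)^{n+1}}{(2(n+1))!}\sum_{\nu=1}^Na_\nu\nu^{2(n+1)},\qquad c_{nm}=\sum_{\substack{l_1,\dots,l_m\ge N\\l_1+\dots+l_m=n}}b_{l_1}\cdots b_{l_m}\ (m\ge1),$$ $$\mathcal P_n(\xi)=\sum_{1\le m\le n/N}\frac{c_{nm}\xi^{2(n+m)}}{m!},\qquad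 d_{Jn}=\sum_{1\le m\le\min(n/N,J)}(-1)^m\binom Jm c_{nm},$$ $$\mathcal Q_{Jn}(\xi)=0\ (N\le n\le2N-1),\qquad \mathcal Q_{Jn}(\xi)=\sum_{\substack{l_1,l_2\ge N\\l_1+l_2=n}}d_{Jl_1}\xi^{2l_1}\mathcal P_{l_2}(\xi)\ (n\ge2N),$$ $$\mathcal R_{Jn}(\xi)=(-1)^J\xi^{2J}\bigl(d_{Jn}\xi^{2n}+\mathcal P_n(\xi)+\mathcal Q_{Jn}(\xi)\bigr).$$ *)

theory Defs
  imports "HOL-Analysis.Analysis" "HOL-Computational_Algebra.Polynomial"
begin

definition fd_coeffs :: "nat \<Rightarrow> (nat \<Rightarrow> real) \<Rightarrow> bool" where
  "fd_coeffs N a \<longleftrightarrow>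
     (\<Sum>\<nu>=1..N. a \<nu> * real \<nu> ^ 2) = 1 \<and>
     (\<forall>m\<in>{2..N}. (\<Sum>\<nu>=1..N. a \<nu> * real \<nu> ^ (2 * m)) = 0)"

definition discrete_laplacian ::
  "nat \<Rightarrow> (nat \<Rightarrow> real) \<Rightarrow> (int \<Rightarrow> complex) \<Rightarrow> int \<Rightarrow> complex" where
  "discrete_laplacian N a w x =
     (\<Sum>\<nu>=1..N. complex_of_real (a \<nu>) * (w (x - int \<nu>) - 2 * w x + w (x + int \<nu>)))"

definition rapidly_decreasing :: "(int \<Rightarrow> complex) \<Rightarrow> bool" where
  "rapidly_decreasing w \<longleftrightarrow>
     (\<forall>k::nat. \<exists>C. \<forall>x. real_of_int \<bar>x\<bar> ^ k * norm (w x) \<le> C)"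

(* The derivative is taken within the half-line, hence one-sided at 0: the values of f
   at negative arguments are irrelevant. *)
definition C1_on_halfline :: "(real \<Rightarrow> complex) \<Rightarrow> bool" where
  "C1_on_halfline f \<longleftrightarrow>
     (\<exists>f'. (\<forall>t\<ge>0. (f has_vector_derivative f' t) (at t within {0..})) \<and>
           continuous_on {0..} f')"

abbreviation dt :: "(real \<Rightarrow> complex) \<Rightarrow> real \<Rightarrow> complex" where
  "dt f \<equiv> \<lambda>t. vector_derivative f (at t)"

(* u x t is only constrained for t \<ge> 0.  Decrease in x is required for each t
   separately, with no uniformity in t. *)
definition first_discrete_green ::
  "nat \<Rightarrow> (nat \<Rightarrow> real) \<Rightarrow> (int \<Rightarrow> real \<Rightarrow> complex) \<Rightarrow> bool" where
  "first_discrete_green N a u \<longleftrightarrow>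
     (\<forall>t\<ge>0. rapidly_decreasing (\<lambda>x. u x t)) \<and>
     (\<forall>x. C1_on_halfline (u x)) \<and>
     (\<forall>x. \<forall>t>0. dt (u x) t - discrete_laplacian N a (\<lambda>y. u y t) x = 0) \<and>
     u 0 0 = 1 \<and> (\<forall>x. x \<noteq> 0 \<longrightarrow> u x 0 = 0)"

definition heat_profile :: "real \<Rightarrow> real" where
  "heat_profile y = 1 / (2 * sqrt pi) * exp (- (y ^ 2) / 4)"

(* The symbol of minus the discrete Laplacian is
   A(\<theta>) = \<theta>^2 - (\<Sum>n\<ge>N. coef_b N a n * \<theta>^(2*(n+1))). *)
definition coef_b :: "nat \<Rightarrow> (nat \<Rightarrow> real) \<Rightarrow> nat \<Rightarrow> real" where
  "coef_b N a n =
     2 * (-1) ^ (n + 1) / fact (2 * (n + 1)) * (\<Sum>\<nu>=1..N. a \<nu> * real \<nu> ^ (2 * (n + 1)))"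

(* The tuple (l_1, ..., l_m) is encoded as a list of length m; since the entries sum
   to n, the index set is finite. *)
definition coef_c :: "nat \<Rightarrow> (nat \<Rightarrow> real) \<Rightarrow> nat \<Rightarrow> nat \<Rightarrow> real" where
  "coef_c N a n m =
     (\<Sum>ls | length ls = m \<and> (\<forall>l\<in>set ls. N \<le> l) \<and> sum_list ls = n.
        prod_list (map (coef_b N a) ls))"

(* For N \<ge> 1 the condition m \<le> n / N on a natural number m is m \<le> n div N. *)
definition poly_P :: "nat \<Rightarrow> (nat \<Rightarrow> real) \<Rightarrow> nat \<Rightarrow> real poly" where
  "poly_P N a n = (\<Sum>m=1..n div N. monom (coef_c N a n m / fact m) (2 * (n + m)))"

definition coef_d :: "nat \<Rightarrow> (nat \<Rightarrow> real) \<Rightarrow> nat \<Rightarrow> nat \<Rightarrow> real" where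
  "coef_d N a J n =
     (\<Sum>m=1..min (n div N) J. (-1) ^ m * real (J choose m) * coef_c N a n m)"

definition poly_Q :: "nat \<Rightarrow> (nat \<Rightarrow> real) \<Rightarrow> nat \<Rightarrow> nat \<Rightarrow> real poly" where
  "poly_Q N a J n =
     (if n < 2 * N then 0
      else (\<Sum>(l1, l2) | N \<le> l1 \<and> N \<le> l2 \<and> l1 + l2 = n.
              monom (coef_d N a J l1) (2 * l1) * poly_P N a l2))"

definition poly_R :: "nat \<Rightarrow> (nat \<Rightarrow> real) \<Rightarrow> nat \<Rightarrow> nat \<Rightarrow> real poly" where
  "poly_R N a J n =
     monom ((-1) ^ J) (2 * J) *
       (monom (coef_d N a J n) (2 * n) + poly_P N a n + poly_Q N a J n)"

(* The differential operator p(-i d/dx). *)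
definition poly_diff_op :: "real poly \<Rightarrow> (real \<Rightarrow> real) \<Rightarrow> real \<Rightarrow> complex" where
  "poly_diff_op p f y =
     (\<Sum>k\<le>degree p. complex_of_real (coeff p k) * (- \<i>) ^ k * complex_of_real ((deriv ^^ k) f y))"

definition profile_zero :: "nat \<Rightarrow> real \<Rightarrow> complex" where
  "profile_zero J y = complex_of_real ((deriv ^^ (2 * J)) heat_profile y)"

definition profile :: "nat \<Rightarrow> (nat \<Rightarrow> real) \<Rightarrow> nat \<Rightarrow> nat \<Rightarrow> real \<Rightarrow> complex" where
  "profile N a J n = poly_diff_op (poly_R N a J n) heat_profile"

end

theory Submission
  imports Defs "HOL-Probability.Characteristic_Functions"
begin

text \<open>
  The Green function is identified with the Fourier integral of \<open>exp (- t * A \<theta>)\<close>, where \<open>A\<close> is the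
  symbol of minus the discrete Laplacian. Its time derivatives are then Fourier integrals of
  \<open>(- A \<theta>) ^ J * exp (- t * A \<theta>)\<close>. Write \<open>A \<theta> = \<theta>\<^sup>2 * (1 - \<beta> \<theta>)\<close> and \<open>\<tau> = t * \<theta>\<^sup>2\<close>; up to the
  factor \<open>(- 1) ^ J * \<theta> ^ (2 * J) * exp (- \<tau>)\<close> the integrand is \<open>(1 - \<beta>) ^ J * exp (\<tau> * \<beta>)\<close>. Expanding
  it in powers of \<open>\<theta>\<^sup>2\<close> up to order \<open>K1\<close> with \<open>\<tau>\<close> as a parameter produces exactly the polynomials
  \<open>poly_R\<close>, and the Gaussian integrals of the terms are the profiles. Since \<open>A \<theta> \<ge> c * \<theta>\<^sup>2\<close> on
  \<open>[- pi, pi]\<close>, the error is bounded by a constant times \<open>exp (- \<kappa> * \<tau>) * \<theta> ^ (2 * (J + K1 + 1))\<close> for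
  all real \<open>\<theta>\<close>, and scaling gives the power of \<open>t\<close>. The lower bound on \<open>A\<close> holds because the second
  derivative of \<open>A\<close> is \<open>2 + \<gamma> * (1 - cos \<theta>) ^ N\<close>, so that its first derivative is concave on \<open>[0, pi]\<close>
  and vanishes at both ends.
\<close>

section \<open>Uniqueness for the lattice heat equation\<close>

text \<open>Uniqueness is the delicate point of the identification. Decay in x is required for each
  time separately, so the supremum over x need not a priori be locally bounded in t, and a Gronwall
  argument cannot start. The lattice Laplacian is a bounded operator, so the equation can also be
  followed backwards in time; this is what lets a category argument close the gap.

  In the expansion, \<open>\<tau>\<close> is kept apart from \<open>\<theta>\<close> because the
  mass of the Gaussian lies where \<open>\<tau>\<close> is of order one: at fixed
  \<open>\<tau>\<close>, each factor \<open>\<theta>\<^sup>2\<close> is worth a factor 1/t. Since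
  \<open>\<beta> \<theta>\<close> is O(\<open>\<theta>\<^sup>2\<close>), the m-th term of the
  exponential series has order at least \<open>\<theta> ^ (2 * m)\<close>, so one cutoff serves both
  that series and the powers of \<open>\<theta>\<^sup>2\<close>. The Gaussian times
  \<open>exp (\<tau> * \<beta> \<theta>)\<close> is \<open>exp (- t * A \<theta>)\<close> again, so
  its decay must come from a lower bound on the whole interval and not only near 0.\<close>

definition stencil_bound :: "nat \<Rightarrow> (nat \<Rightarrow> real) \<Rightarrow> real" where
  "stencil_bound N a = (\<Sum>\<nu>=1..N. 4 * \<bar>a \<nu>\<bar>)"

lemma stencil_bound_nonneg: "0 \<le> stencil_bound N a"
  unfolding stencil_bound_def by (intro sum_nonneg) auto

text \<open>The weights 1, 2, 1 of the stencil add up to 4. This boundedness makes the equation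
  tractable in both directions of time.\<close>

lemma norm_discrete_laplacian_le:
  assumes "\<And>x. norm (w x) \<le> M"
  shows "norm (discrete_laplacian N a w x) \<le> stencil_bound N a * M"
proof -
  have "norm (w y - 2 * w x + w z) \<le> 4 * M" for y z
  proof -
    have "norm (w y - 2 * w x + w z) \<le> norm (w y) + norm (2 * w x) + norm (w z)"
      by (meson norm_triangle_ineq norm_triangle_ineq4 add_right_mono order_trans)
    then show ?thesis
      using assms[of y] assms[of x] assms[of z] by (simp add: norm_mult)
  qed
  then have "norm (discrete_laplacian N a w x) \<le> (\<Sum>\<nu>=1..N. \<bar>a \<nu>\<bar> * (4 * M))"
    unfolding discrete_laplacian_def
    by (intro sum_norm_le) (auto simp: norm_mult intro!: mult_left_mono)
  also have "\<dots> = stencil_bound N a * M"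
    unfolding stencil_bound_def sum_distrib_right by (intro sum.cong) auto
  finally show ?thesis .
qed

text \<open>Two-sided derivatives on the whole time line, without any decay: reversing time then
  only changes the sign of \<open>a\<close>.\<close>

definition lattice_heat_solution ::
  "nat \<Rightarrow> (nat \<Rightarrow> real) \<Rightarrow> (int \<Rightarrow> real \<Rightarrow> complex) \<Rightarrow> bool" where
  "lattice_heat_solution N a w \<longleftrightarrow>
     (\<forall>x t. (w x has_vector_derivative discrete_laplacian N a (\<lambda>y. w y t) x) (at t))"

lemma lattice_heat_solution_continuous:
  "lattice_heat_solution N a w \<Longrightarrow> continuous_on S (w x)"
  unfolding lattice_heat_solution_def
  by (meson continuous_at_imp_continuous_on has_vector_derivative_continuous)

lemma lattice_heat_solution_reverse:
  assumes "lattice_heat_solution N a w"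
  shows "lattice_heat_solution N (\<lambda>\<nu>. - a \<nu>) (\<lambda>x t. w x (- t))"
  unfolding lattice_heat_solution_def
proof (intro allI)
  fix x t
  have "((w x \<circ> uminus) has_vector_derivative
      (-1) *\<^sub>R discrete_laplacian N a (\<lambda>y. w y (- t)) x) (at t)"
    using assms unfolding lattice_heat_solution_def
    by (intro vector_diff_chain_at) (auto intro!: derivative_eq_intros)
  then show "((\<lambda>t. w x (- t)) has_vector_derivative
      discrete_laplacian N (\<lambda>\<nu>. - a \<nu>) (\<lambda>y. w y (- t)) x) (at t)"
    by (simp add: o_def discrete_laplacian_def sum_negf)
qed

text \<open>The weight \<open>exp (2 * C * r)\<close> makes the integral operator of the equation a
  contraction with factor 1/2, so the weighted supremum is at most twice the initial one.\<close>
lemma lattice_heat_solution_forward_bound: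
  assumes sol: "lattice_heat_solution N a w"
    and bd: "\<And>x r. r \<in> {s..t} \<Longrightarrow> norm (w x r) \<le> M"
    and B: "\<And>x. norm (w x s) \<le> B" and r: "r \<in> {s..t}"
  shows "norm (w x r) \<le> 2 * B * exp (2 * stencil_bound N a * (r - s))"
proof -
  define C where "C = stencil_bound N a"
  have C: "0 \<le> C" unfolding C_def by (rule stencil_bound_nonneg)
  have B0: "0 \<le> B" using B[of 0] norm_ge_zero order_trans by blast
  define g where "g = (\<lambda>(x, r). norm (w x r) * exp (- (2 * C * (r - s))))"
  define S where "S = (SUP p\<in>UNIV \<times> {s..t}. g p)"
  have "g p \<le> M" if "p \<in> UNIV \<times> {s..t}" for p
  proof -
    obtain x r where xr: "p = (x, r)" by (cases p)
    then have p: "p = (x, r)" "r \<in> {s..t}" using that by auto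
    have "g p \<le> norm (w x r)"
      unfolding g_def using p C by (auto intro!: mult_left_le)
    then show ?thesis using bd[OF p(2), of x] by simp
  qed
  then have bdd: "bdd_above (g ` (UNIV \<times> {s..t}))" by (auto simp: bdd_above_def)
  have le_S: "norm (w x r) \<le> S * exp (2 * C * (r - s))" if "r \<in> {s..t}" for x r
  proof -
    have "g (x, r) \<le> S" unfolding S_def using that bdd by (intro cSUP_upper) auto
    then have "norm (w x r) * exp (- (2 * C * (r - s))) * exp (2 * C * (r - s))
        \<le> S * exp (2 * C * (r - s))"
      unfolding g_def by (intro mult_right_mono) auto
    then show ?thesis by (simp add: mult.assoc flip: exp_add)
  qed
  have S0: "0 \<le> S" using le_S[OF r, of 0] norm_ge_zero
    by (metis exp_gt_zero order_trans zero_le_mult_iff not_le)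
  have "norm (w x r) \<le> (B + S / 2) * exp (2 * C * (r - s))" if "r \<in> {s..t}" for x r
  proof (cases "s = r")
    case True
    then show ?thesis using B[of x] S0 by simp
  next
    case False
    then have "s < r" using that by auto
    \<comment> \<open>An antiderivative of \<open>C * (S * exp (2 * C * (q - s)))\<close>, the bound
      for the Laplacian; the factor 1/2 comes from integrating the rate
      \<open>2 * C\<close>.\<close>
    define \<phi> where "\<phi> = (\<lambda>r. S / 2 * exp (2 * C * (r - s)))"
    have "norm (w x r - w x s) \<le> \<phi> r - \<phi> s"
    proof (rule differentiable_bound_general[OF \<open>s < r\<close>])
      show "continuous_on {s..r} (w x)" by (rule lattice_heat_solution_continuous[OF sol])
      show "continuous_on {s..r} \<phi>" unfolding \<phi>_def by (intro continuous_intros)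
      show "(w x has_vector_derivative discrete_laplacian N a (\<lambda>y. w y q) x) (at q)" for q
        using sol unfolding lattice_heat_solution_def by blast
      show "(\<phi> has_vector_derivative C * (S * exp (2 * C * (q - s)))) (at q)" for q
        unfolding \<phi>_def has_real_derivative_iff_has_vector_derivative[symmetric]
        by (auto intro!: derivative_eq_intros)
      show "norm (discrete_laplacian N a (\<lambda>y. w y q) x) \<le> C * (S * exp (2 * C * (q - s)))"
        if "s < q" "q < r" for q
        unfolding C_def[symmetric]
        using le_S[of q] that \<open>r \<in> {s..t}\<close>
        by (intro norm_discrete_laplacian_le[of _ _ N a, folded C_def]) auto
    qed
    moreover have "norm (w x r) \<le> norm (w x r - w x s) + norm (w x s)"
      by (metis diff_add_cancel norm_triangle_ineq)
    ultimately have "norm (w x r) \<le> B + (\<phi> r - \<phi> s)" using B[of x] by simp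
    also have "\<dots> \<le> B * exp (2 * C * (r - s)) + \<phi> r"
      using B0 S0 C \<open>s < r\<close> mult_left_mono[of 1 "exp (2 * C * (r - s))" B]
      unfolding \<phi>_def by auto
    finally show ?thesis unfolding \<phi>_def by (simp add: distrib_right)
  qed
  then have "g (x, r) \<le> B + S / 2" if "r \<in> {s..t}" for x r
    using that unfolding g_def by (simp add: exp_minus divide_le_eq flip: divide_inverse)
  then have "S \<le> B + S / 2" unfolding S_def using r by (intro cSUP_least) (auto simp del: split_paired_All)
  then have "S \<le> 2 * B" by simp
  then have "S * exp (2 * C * (r - s)) \<le> 2 * B * exp (2 * C * (r - s))"
    by (intro mult_right_mono) auto
  then show ?thesis using le_S[OF r, of x] unfolding C_def by (rule order_trans[rotated])
qed

text \<open>Reversed time satisfies the equation for \<open>- a\<close>, and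
  \<open>stencil_bound\<close> depends on absolute values only.\<close>

lemma lattice_heat_solution_backward_bound:
  assumes sol: "lattice_heat_solution N a w"
    and bd: "\<And>x r. r \<in> {s..t} \<Longrightarrow> norm (w x r) \<le> M"
    and B: "\<And>x. norm (w x t) \<le> B" and r: "r \<in> {s..t}"
  shows "norm (w x r) \<le> 2 * B * exp (2 * stencil_bound N a * (t - r))"
proof -
  have "norm (w x (- (- r))) \<le>
      2 * B * exp (2 * stencil_bound N (\<lambda>\<nu>. - a \<nu>) * (- r - (- t)))"
    by (rule lattice_heat_solution_forward_bound
        [OF lattice_heat_solution_reverse[OF sol], where t = "- s" and M = M])
      (use bd B r in auto)
  then show ?thesis by (simp add: stencil_bound_def)
qed

section \<open>Boundedness in space, locally uniform in time\<close>

definition locally_bounded_at :: "(int \<Rightarrow> real \<Rightarrow> complex) \<Rightarrow> real \<Rightarrow> bool" where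
  "locally_bounded_at w t \<longleftrightarrow>
     (\<exists>e>0. \<exists>B. \<forall>x s. dist s t < e \<longrightarrow> norm (w x s) \<le> B)"

lemma open_locally_bounded_at: "open {t. locally_bounded_at w t}"
  unfolding open_contains_ball
proof
  fix t assume "t \<in> {t. locally_bounded_at w t}"
  then obtain e B where e: "e > 0" "\<And>x s. dist s t < e \<Longrightarrow> norm (w x s) \<le> B"
    unfolding locally_bounded_at_def by auto
  have "locally_bounded_at w r" if "r \<in> ball t (e / 2)" for r
  proof -
    have "norm (w x s) \<le> B" if "dist s r < e / 2" for x s
      using \<open>r \<in> ball t (e / 2)\<close> that dist_triangle_half_r[of r t e s]
      by (intro e(2)) (simp add: dist_commute)
    then show ?thesis
      unfolding locally_bounded_at_def using half_gt_zero[OF e(1)] by blast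
  qed
  then show "\<exists>e>0. ball t e \<subseteq> {t. locally_bounded_at w t}"
    using half_gt_zero[OF e(1)] by blast
qed

text \<open>Compactness in the form of the bisection principle: bounds on adjacent intervals
  combine, and short intervals around each point have one.\<close>

lemma locally_bounded_interval:
  assumes "s \<le> t" "\<And>r. r \<in> {s..t} \<Longrightarrow> locally_bounded_at w r"
  obtains M where "\<And>x r. r \<in> {s..t} \<Longrightarrow> norm (w x r) \<le> M"
proof -
  define P where "P = (\<lambda>p q. s \<le> p \<longrightarrow> q \<le> t \<longrightarrow> (\<exists>M. \<forall>x. \<forall>r\<in>{p..q}. norm (w x r) \<le> M))"
  have "P s t"
  proof (rule Bolzano[OF assms(1)])
    fix p q r assume *: "P p q" "P q r" "p \<le> q" "q \<le> r"
    show "P p r" unfolding P_def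
    proof (intro impI)
      assume "s \<le> p" "r \<le> t"
      then obtain M M' where "\<forall>x. \<forall>r\<in>{p..q}. norm (w x r) \<le> M"
        "\<forall>x. \<forall>r\<in>{q..r}. norm (w x r) \<le> M'"
        using * unfolding P_def by fastforce
      then have "\<forall>x. \<forall>r\<in>{p..r}. norm (w x r) \<le> max M M'"
        by (metis atLeastAtMost_iff linear max.coboundedI1 max.coboundedI2)
      then show "\<exists>M. \<forall>x. \<forall>r\<in>{p..r}. norm (w x r) \<le> M" by blast
    qed
  next
    fix r assume "s \<le> r" "r \<le> t"
    then obtain e B where e: "e > 0" "\<And>x q. dist q r < e \<Longrightarrow> norm (w x q) \<le> B"
      using assms(2)[of r] unfolding locally_bounded_at_def by auto
    show "\<exists>d>0. \<forall>p q. p \<le> r \<and> r \<le> q \<and> q - p < d \<longrightarrow> P p q"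
      unfolding P_def using e
      by (intro exI[of _ e]) (auto simp: dist_real_def intro!: exI[of _ B])
  qed
  then show ?thesis using that unfolding P_def by blast
qed

text \<open>Only boundedness for each single time is assumed. By Baire's theorem the solution is
  uniformly bounded on a relatively open piece of the closed set of times at which local
  boundedness fails; the propagation bounds in both time directions extend this bound across
  the gaps of that set, so the set is empty.\<close>
lemma lattice_heat_solution_locally_bounded:
  assumes sol: "lattice_heat_solution N a w"
    and bd: "\<And>t. bounded (range (\<lambda>x. w x t))"
  shows "locally_bounded_at w t"
proof (rule ccontr)
  assume "\<not> locally_bounded_at w t"
  define F where "F = {t. \<not> locally_bounded_at w t}"
  define E where "E = (\<lambda>n::nat. {t. \<forall>x. norm (w x t) \<le> real n})"
  have closedF: "closed F"
    using open_locally_bounded_at[of w] unfolding F_def closed_def Compl_eq by simp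
  have closedE: "closed (E n)" for n
    unfolding E_def by (intro closed_Collect_all closed_Collect_le continuous_on_norm
        lattice_heat_solution_continuous[OF sol] continuous_on_const)
  have "\<exists>n. t \<in> E n" for t
  proof -
    obtain M where "\<And>x. norm (w x t) \<le> M" using bd[of t] by (auto simp: bounded_iff)
    moreover obtain n :: nat where "M \<le> real n" using real_arch_simple by blast
    ultimately show ?thesis unfolding E_def by (auto intro: order_trans)
  qed
  then have inter: "\<Inter> (range (\<lambda>n. F - E n)) = {}" by auto
  \<comment> \<open>The sets \<open>F - E n\<close> are relatively open in \<open>F\<close>. If all
    were dense in it, their empty intersection would be dense in the nonempty
    \<open>F\<close>.\<close>
  have "\<exists>n. \<not> F \<subseteq> closure (F - E n)"
  proof (rule ccontr)
    assume "\<not> ?thesis"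
    then have "F \<subseteq> closure (\<Inter> (range (\<lambda>n. F - E n)))"
      by (intro Baire[OF closedF]) (auto simp: closedE Diff_eq intro!: openin_open_Int)
    then have "F = {}" unfolding inter closure_empty by (rule subset_empty[THEN iffD1])
    then show False using \<open>\<not> locally_bounded_at w t\<close> F_def by blast
  qed
  then obtain n t0 where t0: "t0 \<in> F" "t0 \<notin> closure (F - E n)" by blast
  from t0(2) obtain e where e: "e > 0" "\<And>s. s \<in> F \<Longrightarrow> dist s t0 < e \<Longrightarrow> s \<in> E n"
    unfolding closure_approachable by (metis DiffI)
  \<comment> \<open>A starting time with a known bound to the left of every \<open>s\<close> in the
    smaller ball, in case no point of \<open>F\<close> lies between.\<close>
  define p where "p = t0 - e / 2"
  obtain Mp where Mp: "\<And>x. norm (w x p) \<le> Mp" using bd[of p] by (auto simp: bounded_iff)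
  define B where "B = max (real n) Mp"
  have B0: "0 \<le> B" unfolding B_def by simp
  define C where "C = stencil_bound N a"
  have C: "0 \<le> C" unfolding C_def by (rule stencil_bound_nonneg)
  have "norm (w x s) \<le> 2 * B * exp (2 * C * (2 * e))" if s: "dist s t0 < e / 2" for x s
  proof -
    have ps: "p < s" "s < t0 + e / 2"
      using s unfolding p_def dist_real_def abs_less_iff by linarith+
    \<comment> \<open>\<open>\<alpha>\<close> will be the last point of
      \<open>F \<union> {p}\<close> up to \<open>s\<close>. There the bound \<open>B\<close> holds,
      which does not depend on \<open>s\<close>, and local boundedness holds at all later times up
      to \<open>s\<close>.\<close>
    have "compact ({p..s} \<inter> (F \<union> {p}))"
      using closedF by (intro compact_Int_closed) auto
    moreover have "{p..s} \<inter> (F \<union> {p}) \<noteq> {}" using ps by auto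
    ultimately obtain \<alpha> where \<alpha>: "\<alpha> \<in> {p..s}" "\<alpha> \<in> F \<union> {p}"
      "\<And>r. r \<in> {p..s} \<inter> (F \<union> {p}) \<Longrightarrow> r \<le> \<alpha>"
      using compact_attains_sup[of "{p..s} \<inter> (F \<union> {p})"] by blast
    have B\<alpha>: "norm (w y \<alpha>) \<le> B" for y
    proof (cases "\<alpha> = p")
      case True then show ?thesis using Mp[of y] unfolding B_def by simp
    next
      case False
      then have "\<alpha> \<in> F" using \<alpha> by auto
      moreover have "dist \<alpha> t0 < e" using \<alpha>(1) ps e(1) unfolding p_def dist_real_def by auto
      ultimately have "\<alpha> \<in> E n" by (rule e(2))
      then show ?thesis unfolding E_def B_def by (auto intro: max.coboundedI1)
    qed
    \<comment> \<open>The forward bound from \<open>\<alpha>\<close> presupposes some bound on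
      \<open>{\<alpha>..s}\<close>, but local boundedness may fail at \<open>\<alpha>\<close>.
      Propagation backwards from \<open>s\<close> gives one that is uniform over all times after
      \<open>\<alpha>\<close>. It depends on \<open>s\<close> through \<open>Ms\<close>, but the
      conclusion of the forward bound no longer contains it.\<close>
    obtain Ms where Ms: "\<And>x. norm (w x s) \<le> Ms" using bd[of s] by (auto simp: bounded_iff)
    have Ms0: "0 \<le> Ms" using Ms[of 0] norm_ge_zero order_trans by blast
    have "norm (w y r) \<le> max B (2 * Ms * exp (2 * C * (s - \<alpha>)))" if r: "r \<in> {\<alpha>..s}" for y r
    proof (cases "r = \<alpha>")
      case True then show ?thesis using B\<alpha>[of y] by simp
    next
      case False
      then have "locally_bounded_at w q" if "q \<in> {r..s}" for q
        using \<alpha>(1) \<alpha>(3)[of q] that r unfolding F_def by fastforce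
      then obtain M where M: "\<And>x q. q \<in> {r..s} \<Longrightarrow> norm (w x q) \<le> M"
        using locally_bounded_interval[of r s w] r by auto
      have "norm (w y r) \<le> 2 * Ms * exp (2 * C * (s - r))"
        unfolding C_def
        by (rule lattice_heat_solution_backward_bound[OF sol, where s = r and M = M])
          (use M Ms r in auto)
      also have "\<dots> \<le> 2 * Ms * exp (2 * C * (s - \<alpha>))"
        using r C Ms0 by (auto intro!: mult_left_mono)
      finally show ?thesis by simp
    qed
    then have "norm (w x s) \<le> 2 * B * exp (2 * C * (s - \<alpha>))"
      unfolding C_def using B\<alpha> \<alpha>(1)
      by (intro lattice_heat_solution_forward_bound[OF sol, of \<alpha> s]) auto
    also have "C * (s - \<alpha>) \<le> C * (2 * e)"
      using C \<alpha>(1) ps e(1) unfolding p_def by (intro mult_left_mono) auto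
    then have "2 * B * exp (2 * C * (s - \<alpha>)) \<le> 2 * B * exp (2 * C * (2 * e))"
      using B0 by (intro mult_left_mono) auto
    finally show ?thesis .
  qed
  then have "locally_bounded_at w t0"
    unfolding locally_bounded_at_def using e(1) by (intro exI[of _ "e / 2"]) auto
  then show False using t0(1) unfolding F_def by simp
qed

lemma lattice_heat_solution_unique:
  assumes sol: "lattice_heat_solution N a w"
    and bd: "\<And>t. bounded (range (\<lambda>x. w x t))"
    and init: "\<And>x. w x 0 = 0" and "0 \<le> t"
  shows "w x t = 0"
proof -
  obtain M where M: "\<And>x r. r \<in> {0..t} \<Longrightarrow> norm (w x r) \<le> M"
    using locally_bounded_interval[OF \<open>0 \<le> t\<close>, of w]
      lattice_heat_solution_locally_bounded[OF sol bd] by blast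
  have "norm (w x t) \<le> 2 * 0 * exp (2 * stencil_bound N a * (t - 0))"
    by (rule lattice_heat_solution_forward_bound[OF sol M]) (use init \<open>0 \<le> t\<close> in auto)
  then show ?thesis by simp
qed

section \<open>The symbol of the discrete Laplacian\<close>

definition symbol :: "nat \<Rightarrow> (nat \<Rightarrow> real) \<Rightarrow> real \<Rightarrow> real" where
  "symbol N a \<theta> = 2 * (\<Sum>\<nu>=1..N. a \<nu> * (1 - cos (real \<nu> * \<theta>)))"

lemma sum_cos_coeff_even:
  "(\<Sum>m<2 * n. cos_coeff m * x ^ m) = (\<Sum>k<n. (- 1) ^ k * x ^ (2 * k) / fact (2 * k))"
proof (induction n)
  case (Suc n)
  have "(\<Sum>m<2 * Suc n. cos_coeff m * x ^ m) =
      (\<Sum>m<2 * n. cos_coeff m * x ^ m) + cos_coeff (2 * n) * x ^ (2 * n)"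
    by (simp add: cos_coeff_def)
  also have "cos_coeff (2 * n) * x ^ (2 * n) = (- 1) ^ n * x ^ (2 * n) / fact (2 * n)"
    by (simp add: cos_coeff_def)
  finally show ?case using Suc by simp
qed simp

lemma abs_cos_minus_Taylor_le:
  fixes x :: real
  shows "\<bar>cos x - (\<Sum>k<n. (- 1) ^ k * x ^ (2 * k) / fact (2 * k))\<bar> \<le> x ^ (2 * n) / fact (2 * n)"
proof -
  obtain t where "cos x = (\<Sum>m<2 * n. cos_coeff m * x ^ m)
      + (cos (t + 1 / 2 * real (2 * n) * pi) / fact (2 * n)) * x ^ (2 * n)"
    using Maclaurin_cos_expansion[of x "2 * n"] by blast
  then have "\<bar>cos x - (\<Sum>k<n. (- 1) ^ k * x ^ (2 * k) / fact (2 * k))\<bar>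
      = \<bar>cos (t + 1 / 2 * real (2 * n) * pi)\<bar> * (x ^ (2 * n) / fact (2 * n))"
    unfolding sum_cos_coeff_even by (simp add: abs_mult power_even_abs)
  also have "\<dots> \<le> 1 * (x ^ (2 * n) / fact (2 * n))"
    by (intro mult_right_mono) auto
  finally show ?thesis by simp
qed

text \<open>The sum starts at \<open>n = 0\<close>, so \<open>coef_b N a 0\<close> carries the
  leading term of the symbol with opposite sign. The moment conditions come in later, through
  \<open>coef_b_0\<close> and \<open>coef_b_eq_0\<close>.\<close>

lemma symbol_Taylor:
  obtains C where "0 \<le> C"
    "\<And>\<theta>. \<bar>symbol N a \<theta> + (\<Sum>n\<le>K. coef_b N a n * \<theta> ^ (2 * (n + 1)))\<bar> \<le> C * \<theta> ^ (2 * (K + 2))"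
proof
  define C where "C = (\<Sum>\<nu>=1..N. 2 * \<bar>a \<nu>\<bar> * (real \<nu> ^ (2 * (K + 2)) / fact (2 * (K + 2))))"
  show "0 \<le> C" unfolding C_def by (intro sum_nonneg) auto
  fix \<theta> :: real
  \<comment> \<open>There are \<open>K + 2\<close> terms: the constant one cancels against the 1 in
    \<open>1 - cos\<close>, the others, shifted by one, correspond to
    \<open>n \<le> K\<close>.\<close>
  define T where "T = (\<lambda>x::real. \<Sum>k<K + 2. (- 1) ^ k * x ^ (2 * k) / fact (2 * k))"
  have T: "1 - T x = (\<Sum>n\<le>K. - ((- 1) ^ (n + 1) * x ^ (2 * (n + 1)) / fact (2 * (n + 1))))" for x
    unfolding T_def add_2_eq_Suc'
    by (subst sum.lessThan_Suc_shift) (simp add: lessThan_Suc_atMost sum_negf del: sum.lessThan_Suc)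
  have "(\<Sum>n\<le>K. coef_b N a n * \<theta> ^ (2 * (n + 1)))
      = (\<Sum>n\<le>K. \<Sum>\<nu>=1..N. 2 * a \<nu> * ((- 1) ^ (n + 1) * (real \<nu> * \<theta>) ^ (2 * (n + 1))
          / fact (2 * (n + 1))))"
    unfolding coef_b_def sum_distrib_left sum_distrib_right power_mult_distrib
    by (intro sum.cong refl) (simp add: field_simps)
  also have "\<dots> = - (\<Sum>\<nu>=1..N. 2 * a \<nu> * (1 - T (real \<nu> * \<theta>)))"
    unfolding T sum_distrib_left by (subst sum.swap) (simp add: sum_negf)
  finally have "symbol N a \<theta> + (\<Sum>n\<le>K. coef_b N a n * \<theta> ^ (2 * (n + 1)))
      = (\<Sum>\<nu>=1..N. 2 * a \<nu> * (T (real \<nu> * \<theta>) - cos (real \<nu> * \<theta>)))"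
    unfolding symbol_def sum_distrib_left
    by (simp add: algebra_simps flip: sum_subtractf)
  also have "\<bar>\<dots>\<bar> \<le> (\<Sum>\<nu>=1..N. 2 * \<bar>a \<nu>\<bar> * ((real \<nu> * \<theta>) ^ (2 * (K + 2)) / fact (2 * (K + 2))))"
  proof (rule order_trans[OF sum_abs], intro sum_mono)
    fix \<nu>
    have "\<bar>2 * a \<nu> * (T (real \<nu> * \<theta>) - cos (real \<nu> * \<theta>))\<bar>
        = 2 * \<bar>a \<nu>\<bar> * \<bar>cos (real \<nu> * \<theta>) - T (real \<nu> * \<theta>)\<bar>"
      by (simp add: abs_mult abs_minus_commute)
    also have "\<dots> \<le> 2 * \<bar>a \<nu>\<bar> * ((real \<nu> * \<theta>) ^ (2 * (K + 2)) / fact (2 * (K + 2)))"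
      unfolding T_def by (intro mult_left_mono abs_cos_minus_Taylor_le) auto
    finally show "\<bar>2 * a \<nu> * (T (real \<nu> * \<theta>) - cos (real \<nu> * \<theta>))\<bar>
        \<le> 2 * \<bar>a \<nu>\<bar> * ((real \<nu> * \<theta>) ^ (2 * (K + 2)) / fact (2 * (K + 2)))" .
  qed
  also have "\<dots> = C * \<theta> ^ (2 * (K + 2))"
    unfolding C_def sum_distrib_right power_mult_distrib by (intro sum.cong refl) simp
  finally show "\<bar>symbol N a \<theta> + (\<Sum>n\<le>K. coef_b N a n * \<theta> ^ (2 * (n + 1)))\<bar>
      \<le> C * \<theta> ^ (2 * (K + 2))" .
qed

section \<open>Consequences of the moment conditions: shape and lower bound of the symbol\<close>

lemma fd_coeffs_moment:
  assumes "fd_coeffs N a" "1 \<le> k" "k < N"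
  shows "(\<Sum>\<nu>=1..N. a \<nu> * real \<nu> ^ (2 * (k + 1))) = 0"
proof -
  have "k + 1 \<in> {2..N}" using assms by auto
  then show ?thesis using assms(1) unfolding fd_coeffs_def by blast
qed

lemma coef_b_0: "fd_coeffs N a \<Longrightarrow> coef_b N a 0 = - 1"
  unfolding fd_coeffs_def coef_b_def by (simp add: numeral_2_eq_2)

lemma coef_b_eq_0: "fd_coeffs N a \<Longrightarrow> 1 \<le> n \<Longrightarrow> n < N \<Longrightarrow> coef_b N a n = 0"
  unfolding coef_b_def by (simp only: fd_coeffs_moment mult_zero_right)

text \<open>Chebyshev polynomials in the variable \<open>1 - cos \<theta>\<close>. This variable
  vanishes like \<open>\<theta>\<^sup>2\<close> at 0, so an order of vanishing in
  \<open>\<theta>\<close> becomes one of the polynomial.\<close>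

lemma cos_multiple_poly:
  "\<exists>p :: real poly. degree p \<le> n \<and> (\<forall>\<theta>. cos (real n * \<theta>) = poly p (1 - cos \<theta>))"
proof (induction n rule: less_induct)
  case (less n)
  consider "n = 0" | "n = 1" | m where "n = Suc (Suc m)"
    by (metis One_nat_def not0_implies_Suc)
  then show ?case
  proof cases
    case 1 then show ?thesis by (intro exI[of _ 1]) auto
  next
    case 2 then show ?thesis by (intro exI[of _ "[:1, - 1:]"]) auto
  next
    case (3 m)
    obtain p q :: "real poly" where p: "degree p \<le> m" "\<And>\<theta>. cos (real m * \<theta>) = poly p (1 - cos \<theta>)"
      and q: "degree q \<le> Suc m" "\<And>\<theta>. cos (real (Suc m) * \<theta>) = poly q (1 - cos \<theta>)"
      using less[of m] less[of "Suc m"] 3 by auto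
    have "degree ([:2, - 2:] * q - p) \<le> n"
      using p(1) q(1) 3 degree_mult_le[of "[:2, - 2:]" q] by (intro degree_diff_le) auto
    moreover have "cos (real n * \<theta>) = poly ([:2, - 2:] * q - p) (1 - cos \<theta>)" for \<theta>
    proof -
      have "cos (real n * \<theta>) + cos (real m * \<theta>) = 2 * cos \<theta> * cos (real (Suc m) * \<theta>)"
        using cos_plus_cos[of "real n * \<theta>" "real m * \<theta>"] 3
        by (simp add: algebra_simps add_divide_distrib)
      then show ?thesis using p(2)[of \<theta>] q(2)[of \<theta>] by (simp add: algebra_simps)
    qed
    ultimately show ?thesis by blast
  qed
qed

text \<open>Letting \<open>s\<close> tend to 0 kills the constant term; dividing by \<open>s\<close>
  lowers the exponent by one.\<close>

lemma coeff_eq_0_of_power_bound: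
  fixes p :: "real poly"
  assumes "\<And>s. 0 < s \<Longrightarrow> s \<le> 1 \<Longrightarrow> \<bar>poly p s\<bar> \<le> C * s ^ n" "j < n"
  shows "coeff p j = 0"
  using assms
proof (induction n arbitrary: p j)
  case (Suc n)
  have ev: "eventually (\<lambda>s. 0 < s \<and> s \<le> 1) (at_right (0::real))"
    using eventually_at_right_less[of "0::real"] eventually_at_right_real[of 0 1]
    by (auto elim: eventually_mono)
  have "((\<lambda>s. \<bar>poly p s\<bar>) \<longlongrightarrow> \<bar>poly p 0\<bar>) (at_right 0)"
    by (intro tendsto_intros)
  moreover have "((\<lambda>s. C * s ^ Suc n) \<longlongrightarrow> C * 0 ^ Suc n) (at_right 0)"
    by (intro tendsto_intros)
  moreover have "eventually (\<lambda>s. \<bar>poly p s\<bar> \<le> C * s ^ Suc n) (at_right 0)"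
    using ev by (rule eventually_mono) (use Suc.prems(1) in blast)
  ultimately have "\<bar>poly p 0\<bar> \<le> C * 0 ^ Suc n"
    by (intro tendsto_le[OF trivial_limit_at_right_real])
  then have p0: "coeff p 0 = 0" by (simp add: poly_0_coeff_0)
  obtain q where q: "p = pCons 0 q" using p0 by (cases p) auto
  have "\<bar>poly q s\<bar> \<le> C * s ^ n" if "0 < s" "s \<le> 1" for s
    using Suc.prems(1)[OF that] that unfolding q by (simp add: abs_mult mult.left_commute)
  then have "coeff q i = 0" if "i < n" for i using Suc.IH that by blast
  then show ?case using Suc.prems(2) q by (cases j) auto
qed simp

text \<open>From cos x <= 1 - x^2/2 + x^4/24 and x^4 <= 4 x^2. It converts powers of
  \<open>\<theta>\<close> into powers of \<open>1 - cos \<theta>\<close>.\<close>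

lemma square_le_one_minus_cos:
  fixes x :: real assumes "\<bar>x\<bar> \<le> 2" shows "x\<^sup>2 \<le> 4 * (1 - cos x)"
proof -
  have "(\<Sum>k<2. (- 1) ^ k * x ^ (2 * k) / fact (2 * k)) = 1 - x\<^sup>2 / 2"
    by (simp add: lessThan_nat_numeral)
  then have "cos x - (1 - x\<^sup>2 / 2) \<le> x ^ 4 / 24"
    using abs_cos_minus_Taylor_le[of x 2] abs_ge_self[of "cos x - (1 - x\<^sup>2 / 2)"]
    by (simp add: fact_numeral)
  moreover have "x ^ 4 \<le> 4 * x\<^sup>2"
    using mult_right_mono[of "x\<^sup>2" 4 "x\<^sup>2"] power_mono[OF assms, of 2]
    by (simp add: power_even_abs flip: power_add)
  moreover have "p \<le> 4 * (1 - c)" if "c - (1 - p / 2) \<le> q / 24" "q \<le> 4 * p" "0 \<le> p" for c p q :: real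
    using that by (simp add: field_simps)
  ultimately show ?thesis using zero_le_power2[of x] by blast
qed

text \<open>The second derivative minus 2 is a polynomial of degree at most \<open>N\<close> in
  \<open>1 - cos \<theta>\<close> which is of order \<open>\<theta> ^ (2 * N)\<close> at 0; this leaves only the top power.\<close>
lemma symbol_second_derivative:
  assumes "fd_coeffs N a"
  obtains \<kappa> where
    "\<And>\<theta>. 2 * (\<Sum>\<nu>=1..N. a \<nu> * real \<nu> ^ 2 * cos (real \<nu> * \<theta>)) = 2 + \<kappa> * (1 - cos \<theta>) ^ N"
proof -
  obtain P :: "nat \<Rightarrow> real poly" where P: "\<And>n. degree (P n) \<le> n"
    "\<And>n \<theta>. cos (real n * \<theta>) = poly (P n) (1 - cos \<theta>)"
    using cos_multiple_poly by metis
  define D where "D = (\<Sum>\<nu>=1..N. smult (2 * (a \<nu> * real \<nu> ^ 2)) (P \<nu>)) - [:2:]"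
  define g where "g = (\<lambda>\<theta>. 2 * (\<Sum>\<nu>=1..N. a \<nu> * real \<nu> ^ 2 * cos (real \<nu> * \<theta>)))"
  have D: "poly D (1 - cos \<theta>) = g \<theta> - 2" for \<theta>
    unfolding D_def g_def by (simp add: poly_sum P(2) sum_distrib_left mult.assoc)
  have deg: "degree D \<le> N"
    unfolding D_def
    by (intro degree_diff_le degree_sum_le) (auto intro: order_trans[OF degree_smult_le] order_trans[OF P(1)])
  define C where "C = (\<Sum>\<nu>=1..N. \<bar>2 * a \<nu> * real \<nu> ^ 2\<bar> * (real \<nu> ^ (2 * N) / fact (2 * N)))"
  have C0: "0 \<le> C" unfolding C_def by (intro sum_nonneg) auto
  have bound: "\<bar>g \<theta> - 2\<bar> \<le> C * \<theta> ^ (2 * N)" for \<theta>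
  proof -
    \<comment> \<open>The factor \<open>real \<nu> ^ 2\<close> turns the k-th Taylor coefficient of
      cos into the moment of order \<open>2 * (k + 1)\<close>, which is 1 for \<open>k = 0\<close>
      and 0 for \<open>1 \<le> k < N\<close>. Only the constant 2 remains.\<close>
    define T where "T = (\<lambda>x::real. \<Sum>k<N. (- 1) ^ k * x ^ (2 * k) / fact (2 * k))"
    have "(\<Sum>\<nu>=1..N. 2 * a \<nu> * real \<nu> ^ 2 * T (real \<nu> * \<theta>))
        = (\<Sum>k<N. 2 * (- 1) ^ k * \<theta> ^ (2 * k) / fact (2 * k)
            * (\<Sum>\<nu>=1..N. a \<nu> * real \<nu> ^ (2 * (k + 1))))"
      unfolding T_def sum_distrib_left
      by (subst sum.swap, intro sum.cong refl)
        (simp add: power_mult_distrib power_add power2_eq_square)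
    also have "\<dots> = (\<Sum>k<N. if k = 0 then 2 else 0)"
    proof (intro sum.cong refl)
      fix k assume "k \<in> {..<N}"
      then have "(\<Sum>\<nu>=1..N. a \<nu> * real \<nu> ^ (2 * (k + 1))) = (if k = 0 then 1 else 0)"
        using fd_coeffs_moment[OF assms, of k] assms
        unfolding fd_coeffs_def by (cases "k = 0") (simp, simp only: if_False, simp)
      then show "2 * (- 1) ^ k * \<theta> ^ (2 * k) / fact (2 * k)
          * (\<Sum>\<nu>=1..N. a \<nu> * real \<nu> ^ (2 * (k + 1))) = (if k = 0 then 2 else 0)"
        by (simp only: split: if_split) simp
    qed
    also have "\<dots> = 2"
    proof (cases N)
      case 0 then show ?thesis using assms unfolding fd_coeffs_def by simp
    qed simp
    finally have "g \<theta> - 2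
        = (\<Sum>\<nu>=1..N. 2 * a \<nu> * real \<nu> ^ 2 * (cos (real \<nu> * \<theta>) - T (real \<nu> * \<theta>)))"
      unfolding g_def by (simp add: sum_distrib_left right_diff_distrib sum_subtractf mult.assoc)
    also have "\<bar>\<dots>\<bar> \<le> (\<Sum>\<nu>=1..N. \<bar>2 * a \<nu> * real \<nu> ^ 2\<bar> * ((real \<nu> * \<theta>) ^ (2 * N) / fact (2 * N)))"
      unfolding T_def
      by (rule order_trans[OF sum_abs], intro sum_mono, subst abs_mult)
        (intro mult_left_mono abs_cos_minus_Taylor_le abs_ge_zero)
    also have "\<dots> = C * \<theta> ^ (2 * N)"
      unfolding C_def sum_distrib_right power_mult_distrib by (intro sum.cong refl) simp
    finally show ?thesis .
  qed
  have "\<bar>poly D s\<bar> \<le> (C * 4 ^ N) * s ^ N" if "0 < s" "s \<le> 1" for s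
  proof -
    \<comment> \<open>For \<open>s \<le> 1\<close> this angle is at most pi/2, hence within the
      range of \<open>square_le_one_minus_cos\<close>.\<close>
    define \<theta> where "\<theta> = arccos (1 - s)"
    have s: "s = 1 - cos \<theta>" unfolding \<theta>_def using that by (subst cos_arccos) auto
    have "0 \<le> \<theta>" "\<theta> \<le> pi / 2" unfolding \<theta>_def using that arccos_lbound[of "1 - s"] arccos_le_pi2[of "1 - s"] by auto
    then have "\<bar>\<theta>\<bar> \<le> 2" using pi_less_4 by auto
    then have "\<theta>\<^sup>2 \<le> 4 * s" unfolding s by (rule square_le_one_minus_cos)
    then have "\<theta> ^ (2 * N) \<le> (4 * s) ^ N"
      unfolding power_mult by (intro power_mono) auto
    then have "C * \<theta> ^ (2 * N) \<le> C * (4 * s) ^ N" using C0 by (rule mult_left_mono)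
    then show ?thesis
      using bound[of \<theta>] D[of \<theta>] unfolding s[symmetric] by (simp add: power_mult_distrib mult.assoc)
  qed
  then have low: "coeff D j = 0" if "j < N" for j using coeff_eq_0_of_power_bound that by blast
  have "D = monom (coeff D N) N"
  proof (rule poly_eqI)
    fix n show "coeff D n = coeff (monom (coeff D N) N) n"
      using low[of n] deg coeff_eq_0[of D n] by (cases n N rule: linorder_cases) auto
  qed
  then have "poly D s = coeff D N * s ^ N" for s by (metis poly_monom)
  then show ?thesis
    using D that[of "coeff D N"] unfolding g_def by (metis add.commute diff_add_cancel)
qed

lemma symbol_even: "symbol N a (- \<theta>) = symbol N a \<theta>"
  unfolding symbol_def by simp

lemma symbol_0: "symbol N a 0 = 0"
  unfolding symbol_def by simp

lemma symbol_mono: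
  assumes fd: "fd_coeffs N a" and "0 \<le> x" "x \<le> y" "y \<le> pi"
  shows "symbol N a x \<le> symbol N a y"
proof -
  obtain \<kappa> where \<kappa>:
    "\<And>\<theta>. 2 * (\<Sum>\<nu>=1..N. a \<nu> * real \<nu> ^ 2 * cos (real \<nu> * \<theta>)) = 2 + \<kappa> * (1 - cos \<theta>) ^ N"
    using symbol_second_derivative[OF fd] by blast
  define f where "f = (\<lambda>\<theta>. 2 * (\<Sum>\<nu>=1..N. a \<nu> * (real \<nu> * sin (real \<nu> * \<theta>))))"
  have d1: "(symbol N a has_real_derivative f \<theta>) (at \<theta>)" for \<theta>
    unfolding symbol_def[abs_def] f_def
    by (auto intro!: derivative_eq_intros sum.cong simp: mult.commute)
  have d2: "(f has_real_derivative 2 + \<kappa> * (1 - cos \<theta>) ^ N) (at \<theta>)" for \<theta>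
    unfolding f_def \<kappa>[symmetric]
    by (auto intro!: derivative_eq_intros sum.cong simp: power2_eq_square)
  have f0: "f 0 = 0" "f pi = 0" unfolding f_def by (simp_all add: sin_npi)
  \<comment> \<open>The sign is found without computing \<open>\<kappa>\<close>: a positive one
    would make \<open>f\<close> strictly increasing, although it vanishes at both ends. Then the
    derivative of \<open>f\<close> decreases, because \<open>1 - cos\<close> increases on
    \<open>{0..pi}\<close>.\<close>
  have "\<kappa> \<le> 0"
  proof (rule ccontr)
    assume "\<not> ?thesis"
    then have pos: "0 < 2 + \<kappa> * (1 - cos \<theta>) ^ N" for \<theta>
      by (intro add_pos_nonneg) auto
    have "f 0 < f pi"
      by (rule DERIV_pos_imp_increasing[OF pi_gt_zero]) (use d2 pos in blast)
    then show False using f0 by simp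
  qed
  have "convex_on {0..pi} (\<lambda>\<theta>. - f \<theta>)"
  proof (rule convex_on_realI)
    show "connected {0..pi}" by simp
    show "((\<lambda>\<theta>. - f \<theta>) has_real_derivative - (2 + \<kappa> * (1 - cos \<theta>) ^ N)) (at \<theta>)" for \<theta>
      by (intro DERIV_minus d2)
    fix p q :: real assume "p \<in> {0..pi}" "q \<in> {0..pi}" "p \<le> q"
    then have "(1 - cos p) ^ N \<le> (1 - cos q) ^ N"
      by (intro power_mono diff_left_mono) (auto intro: cos_monotone_0_pi_le)
    then show "- (2 + \<kappa> * (1 - cos p) ^ N) \<le> - (2 + \<kappa> * (1 - cos q) ^ N)"
      using mult_left_mono_neg[OF _ \<open>\<kappa> \<le> 0\<close>] by simp
  qed
  then have nonneg: "0 \<le> f \<theta>" if "0 \<le> \<theta>" "\<theta> \<le> pi" for \<theta>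
    using convex_onD[of "{0..pi}" "\<lambda>\<theta>. - f \<theta>" "\<theta> / pi" 0 pi] that f0 by simp
  show ?thesis
    by (rule DERIV_nonneg_imp_nondecreasing[OF \<open>x \<le> y\<close>])
       (use d1 nonneg assms in \<open>meson order_trans\<close>)
qed

lemma symbol_lower_bound:
  assumes "fd_coeffs N a"
  obtains c where "0 < c" "c \<le> 1" "\<And>\<theta>. \<bar>\<theta>\<bar> \<le> pi \<Longrightarrow> c * \<theta>\<^sup>2 \<le> symbol N a \<theta>"
proof -
  obtain C where C: "0 \<le> C" "\<And>\<theta>. \<bar>symbol N a \<theta> - \<theta>\<^sup>2\<bar> \<le> C * \<theta> ^ 4"
    using symbol_Taylor[of N a 0] coef_b_0[OF assms] by (auto simp: power2_eq_square)
  \<comment> \<open>Chosen so that the quartic error is at most half of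
    \<open>\<theta>\<^sup>2\<close> up to \<open>\<delta>\<close>; \<open>\<delta> \<le> 1\<close>
    gives \<open>\<theta>\<^sup>2 \<le> \<delta>\<close> there.\<close>
  define \<delta> where "\<delta> = 1 / (2 * (C + 1))"
  have \<delta>: "0 < \<delta>" "\<delta> \<le> 1" "C * \<delta> \<le> 1 / 2"
    using C(1) unfolding \<delta>_def by (auto simp: field_simps)
  have near: "\<theta>\<^sup>2 / 2 \<le> symbol N a \<theta>" if "0 \<le> \<theta>" "\<theta> \<le> \<delta>" for \<theta>
  proof -
    have "\<theta>\<^sup>2 \<le> \<delta>" using that \<delta> mult_mono[of \<theta> \<delta> \<theta> 1] by (simp add: power2_eq_square)
    then have "C * \<theta>\<^sup>2 \<le> 1 / 2" using mult_left_mono[of "\<theta>\<^sup>2" \<delta> C] C(1) \<delta>(3) by simp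
    then have "C * \<theta>\<^sup>2 * \<theta>\<^sup>2 \<le> 1 / 2 * \<theta>\<^sup>2" by (intro mult_right_mono) auto
    moreover have "C * \<theta>\<^sup>2 * \<theta>\<^sup>2 = C * \<theta> ^ 4" by (simp add: eval_nat_numeral)
    ultimately show ?thesis using C(2)[of \<theta>] by (simp add: abs_le_iff)
  qed
  \<comment> \<open>Beyond \<open>\<delta>\<close>, monotonicity only preserves the value
    \<open>\<delta>\<^sup>2 / 2\<close>, which must still dominate
    \<open>c * pi\<^sup>2\<close>.\<close>
  define c where "c = \<delta>\<^sup>2 / (2 * pi\<^sup>2)"
  have pi1: "1 \<le> pi" using pi_ge_two by simp
  have c: "0 < c" "c \<le> 1 / 2"
    using \<delta> pi1 power_mono[of \<delta> 1 2] power_mono[of 1 pi 2] unfolding c_def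
    by (auto simp: field_simps)
  have "c * \<theta>\<^sup>2 \<le> symbol N a \<theta>" if "0 \<le> \<theta>" "\<theta> \<le> pi" for \<theta>
  proof (cases "\<theta> \<le> \<delta>")
    case True
    have "c * \<theta>\<^sup>2 \<le> 1 / 2 * \<theta>\<^sup>2" using c by (intro mult_right_mono) auto
    then show ?thesis using near[OF that(1) True] by simp
  next
    case False
    have "c * \<theta>\<^sup>2 \<le> c * pi\<^sup>2" using that c by (intro mult_left_mono power_mono) auto
    also have "\<dots> = \<delta>\<^sup>2 / 2" unfolding c_def by simp
    also have "\<dots> \<le> symbol N a \<delta>" using near[of \<delta>] \<delta> by simp
    also have "\<dots> \<le> symbol N a \<theta>" using False that \<delta> by (intro symbol_mono[OF assms]) auto
    finally show ?thesis .
  qed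
  then have "c * \<theta>\<^sup>2 \<le> symbol N a \<theta>" if "\<bar>\<theta>\<bar> \<le> pi" for \<theta>
    using that symbol_even[of N a \<theta>] by (cases "0 \<le> \<theta>") (force, metis abs_le_iff abs_of_nonpos le_cases power2_minus neg_0_le_iff_le)
  then show ?thesis using that[of c] c by auto
qed

section \<open>The coefficients as power series coefficients\<close>

text \<open>The variable stands for \<open>\<theta>\<^sup>2\<close>. Erasing the entries below
  \<open>N\<close> removes \<open>coef_b N a 0 = - 1\<close>, the leading term of the symbol, and
  encodes the constraint that every index of a tuple in \<open>coef_c\<close> is at least
  \<open>N\<close>.\<close>

definition coef_b_fps :: "nat \<Rightarrow> (nat \<Rightarrow> real) \<Rightarrow> real fps" where
  "coef_b_fps N a = Abs_fps (\<lambda>n. if N \<le> n then coef_b N a n else 0)"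

lemma coef_c_eq_0:
  assumes "n < N * m" shows "coef_c N a n m = 0"
proof -
  have "N * length ls \<le> sum_list ls" if "\<forall>l\<in>set ls. N \<le> l" for ls :: "nat list"
    using that by (induction ls) auto
  then have "{ls. length ls = m \<and> (\<forall>l\<in>set ls. N \<le> l) \<and> sum_list ls = n} = {}"
    using assms by (fastforce simp: not_le)
  then show ?thesis unfolding coef_c_def by (metis sum.empty)
qed

text \<open>Splitting a list into head and tail is the Cauchy product of the series with its
  \<open>m\<close>-th power.\<close>

lemma coef_c_eq_fps_nth: "coef_c N a n m = fps_nth (coef_b_fps N a ^ m) n"
proof (induction m arbitrary: n)
  case 0
  have "{ls. length ls = 0 \<and> (\<forall>l\<in>set ls. N \<le> l) \<and> sum_list ls = n} = (if n = 0 then {[]} else {})"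
    by auto
  then show ?case unfolding coef_c_def by simp
next
  case (Suc m)
  define L where "L = (\<lambda>n m. {ls :: nat list. length ls = m \<and> (\<forall>l\<in>set ls. N \<le> l) \<and> sum_list ls = n})"
  have finL: "finite (L n m)" for n m
  proof (rule finite_subset)
    show "L n m \<subseteq> {ls. set ls \<subseteq> {..n} \<and> length ls = m}"
      unfolding L_def using member_le_sum_list by fastforce
    show "finite {ls :: nat list. set ls \<subseteq> {..n} \<and> length ls = m}"
      by (rule finite_lists_length_eq) simp
  qed
  have c: "coef_c N a n m = (\<Sum>ls\<in>L n m. prod_list (map (coef_b N a) ls))" for n m
    unfolding coef_c_def L_def ..
  have "coef_c N a n (Suc m) = (\<Sum>(l, ls)\<in>(SIGMA l:{N..n}. L (n - l) m).
      coef_b N a l * prod_list (map (coef_b N a) ls))"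
    unfolding c
  proof (rule sum.reindex_bij_witness[where i = "\<lambda>(l, ls). l # ls" and j = "\<lambda>ls. (hd ls, tl ls)"])
    fix ls assume "ls \<in> L n (Suc m)"
    then obtain l ks where "ls = l # ks" "length ks = m" "N \<le> l" "\<forall>k\<in>set ks. N \<le> k" "l + sum_list ks = n"
      unfolding L_def by (cases ls) auto
    then show "(case (hd ls, tl ls) of (l, ls) \<Rightarrow> l # ls) = ls"
      "(hd ls, tl ls) \<in> (SIGMA l:{N..n}. L (n - l) m)"
      "(case (hd ls, tl ls) of (l, ls) \<Rightarrow> coef_b N a l * prod_list (map (coef_b N a) ls))
        = prod_list (map (coef_b N a) ls)"
      unfolding L_def by auto
  qed (auto simp: L_def)
  also have "\<dots> = (\<Sum>l\<in>{N..n}. coef_b N a l * coef_c N a (n - l) m)"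
    unfolding c sum_distrib_left by (rule sum.Sigma[symmetric]) (auto simp: finL)
  also have "\<dots> = (\<Sum>l=0..n. fps_nth (coef_b_fps N a) l * fps_nth (coef_b_fps N a ^ m) (n - l))"
    unfolding Suc by (intro sum.mono_neutral_cong_left) (auto simp: coef_b_fps_def)
  finally show ?case by (simp add: fps_mult_nth)
qed

lemma coef_c_0: "coef_c N a n 0 = (if n = 0 then 1 else 0)"
  unfolding coef_c_eq_fps_nth by simp

text \<open>The \<open>m\<close>-th power of the series starts at order \<open>N * m\<close>, so a
  larger upper limit adds only zeros. A limit independent of \<open>n\<close> allows the sums over
  \<open>m\<close> and \<open>n\<close> to be interchanged.\<close>

lemma sum_coef_c_truncate:
  assumes "1 \<le> N" "n div N \<le> M"
  shows "(\<Sum>m=1..M. f m * coef_c N a n m) = (\<Sum>m=1..n div N. f m * coef_c N a n m)"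
proof (intro sum.mono_neutral_right ballI)
  fix m assume "m \<in> {1..M} - {1..n div N}"
  then have "n < N * m" using assms(1)
    by (auto simp: not_le div_less_iff_less_mult mult.commute)
  then show "f m * coef_c N a n m = 0" by (simp add: coef_c_eq_0)
qed (use assms in auto)

text \<open>Binomial theorem. The term \<open>m = 0\<close>, absent from \<open>coef_d\<close>,
  contributes to the constant coefficient only, hence \<open>1 \<le> n\<close>.\<close>

lemma coef_d_eq_fps_nth:
  assumes "1 \<le> N" "1 \<le> n"
  shows "coef_d N a J n = fps_nth ((1 - coef_b_fps N a) ^ J) n"
proof -
  define B where "B = coef_b_fps N a"
  have "(1 - B) ^ J = (- B + 1) ^ J" by simp
  also have "\<dots> = (\<Sum>m\<le>J. of_nat (J choose m) * (- B) ^ m * 1 ^ (J - m))"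
    by (rule binomial_ring)
  also have "\<dots> = (\<Sum>m\<le>J. fps_const ((- 1) ^ m * real (J choose m)) * B ^ m)"
    by (intro sum.cong refl)
      (simp add: power_minus[of B] fps_of_nat flip: fps_const_mult fps_const_power fps_const_neg)
  finally have "fps_nth ((1 - B) ^ J) n = (\<Sum>m\<le>J. (- 1) ^ m * real (J choose m) * coef_c N a n m)"
    unfolding coef_c_eq_fps_nth B_def by (simp add: fps_sum_nth)
  also have "\<dots> = (\<Sum>m=1..J. (- 1) ^ m * real (J choose m) * coef_c N a n m)"
    using assms(2) by (intro sum.mono_neutral_right) (auto simp: coef_c_0 not_le Suc_le_eq)
  also have "\<dots> = (\<Sum>m=1..min (n div N) J. (- 1) ^ m * real (J choose m) * coef_c N a n m)"
  proof (intro sum.mono_neutral_right ballI)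
    fix m assume m: "m \<in> {1..J} - {1..min (n div N) J}"
    then have "n < N * m" using assms(1)
      by (auto simp: not_le div_less_iff_less_mult mult.commute)
    then show "(- 1) ^ m * real (J choose m) * coef_c N a n m = 0" by (simp add: coef_c_eq_0)
  qed auto
  finally show ?thesis unfolding B_def coef_d_def by simp
qed

text \<open>For positive \<open>n\<close> and \<open>N\<close>, the coefficient of
  \<open>y ^ n\<close> in \<open>exp (\<tau> * B y)\<close>, where \<open>B\<close> is the series of
  \<open>coef_b_fps\<close>. At \<open>\<xi>\<close> with \<open>\<xi>\<^sup>2 = \<tau>\<close>,
  \<open>poly_P\<close> is \<open>\<tau> ^ n\<close> times this.\<close>

definition exp_coef :: "nat \<Rightarrow> (nat \<Rightarrow> real) \<Rightarrow> nat \<Rightarrow> real \<Rightarrow> real" where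
  "exp_coef N a n \<tau> = (\<Sum>m=1..n div N. \<tau> ^ m / fact m * coef_c N a n m)"

text \<open>The coefficient of \<open>y ^ n\<close> in \<open>(1 - B y) ^ J * exp (\<tau> * B y)\<close> for the power
  series \<open>B\<close> of \<open>coef_b_fps\<close>.\<close>
lemma sum_fps_nth_eq:
  assumes N: "1 \<le> N" and n: "1 \<le> n" "n \<le> K"
  shows "(\<Sum>m\<le>K. \<tau> ^ m / fact m * fps_nth ((1 - coef_b_fps N a) ^ J * coef_b_fps N a ^ m) n)
    = coef_d N a J n + exp_coef N a n \<tau>
      + (if n < 2 * N then 0
         else \<Sum>(l1, l2) | N \<le> l1 \<and> N \<le> l2 \<and> l1 + l2 = n. coef_d N a J l1 * exp_coef N a l2 \<tau>)"
proof -
  define B where "B = coef_b_fps N a"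
  define p where "p = exp_coef N a"
  define d where "d = coef_d N a J"
  define D where "D = fps_nth ((1 - B) ^ J)"
  have D0: "D 0 = 1" unfolding D_def B_def coef_b_fps_def using N by (simp add: fps_power_zeroth)
  have D: "D l = d l" if "1 \<le> l" for l
    unfolding D_def B_def d_def using coef_d_eq_fps_nth[OF N that] by simp
  have small: "d l = 0" "p l \<tau> = 0" if "l < N" for l
    unfolding d_def p_def coef_d_def exp_coef_def using that by simp_all
  have inner: "(\<Sum>m\<le>K. \<tau> ^ m / fact m * fps_nth (B ^ m) l) = (if l = 0 then 1 else 0) + p l \<tau>"
    if "l \<le> K" for l
  proof -
    have "l div N \<le> K" using that div_le_dividend[of l N] by linarith
    then show ?thesis
      unfolding p_def exp_coef_def using sum_coef_c_truncate[OF N, of l K "\<lambda>m. \<tau> ^ m / fact m" a]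
      by (simp add: B_def coef_c_0 atMost_atLeast0 sum.atLeast_Suc_atMost flip: coef_c_eq_fps_nth)
  qed
  have "(\<Sum>m\<le>K. \<tau> ^ m / fact m * fps_nth ((1 - B) ^ J * B ^ m) n)
      = (\<Sum>i=0..n. D i * (\<Sum>m\<le>K. \<tau> ^ m / fact m * fps_nth (B ^ m) (n - i)))"
    unfolding fps_mult_nth D_def sum_distrib_left
    by (subst sum.swap) (simp add: mult_ac)
  also have "\<dots> = (\<Sum>i=0..n. D i * ((if n - i = 0 then 1 else 0) + p (n - i) \<tau>))"
    using n by (intro sum.cong refl arg_cong2[of _ _ _ _ "(*)"] inner) auto
  \<comment> \<open>The constant term of the exponential factor picks \<open>d n\<close>, the
    constant term \<open>D 0 = 1\<close> of the binomial factor picks \<open>p n \<tau>\<close>. In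
    the mixed terms both indices must reach \<open>N\<close>, which is
    \<open>poly_Q\<close>.\<close>
  also have "\<dots> = (\<Sum>i=0..n. if i = n then D i else 0) + (\<Sum>i=0..n. D i * p (n - i) \<tau>)"
    unfolding sum.distrib[symmetric] by (intro sum.cong refl) (auto simp: algebra_simps)
  also have "(\<Sum>i=0..n. if i = n then D i else 0) = d n" using D n by simp
  also have "(\<Sum>i=0..n. D i * p (n - i) \<tau>) = p n \<tau> + (\<Sum>i=1..n. d i * p (n - i) \<tau>)"
    using D by (simp add: sum.atLeast_Suc_atMost D0)
  also have "(\<Sum>i=1..n. d i * p (n - i) \<tau>)
      = (\<Sum>i | i \<in> {1..n} \<and> N \<le> i \<and> N \<le> n - i. d i * p (n - i) \<tau>)"
    using small by (intro sum.mono_neutral_right) (auto simp flip: not_less)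
  also have "\<dots> = (\<Sum>(l1, l2) | N \<le> l1 \<and> N \<le> l2 \<and> l1 + l2 = n. d l1 * p l2 \<tau>)"
    by (rule sum.reindex_bij_witness[where i = fst and j = "\<lambda>i. (i, n - i)"]) (use N in auto)
  also have "\<dots> = (if n < 2 * N then 0
      else \<Sum>(l1, l2) | N \<le> l1 \<and> N \<le> l2 \<and> l1 + l2 = n. d l1 * p l2 \<tau>)"
  proof (cases "n < 2 * N")
    case True
    then have "{(l1, l2). N \<le> l1 \<and> N \<le> l2 \<and> l1 + l2 = n} = {}" by auto
    then show ?thesis using True by (simp only: sum.empty if_True)
  qed simp
  finally show ?thesis unfolding B_def p_def d_def by simp
qed

lemma sum_fps_nth_eq_0:
  assumes "1 \<le> N" "1 \<le> n" "n < N" "n \<le> K"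
  shows "(\<Sum>m\<le>K. \<tau> ^ m / fact m * fps_nth ((1 - coef_b_fps N a) ^ J * coef_b_fps N a ^ m) n) = 0"
  using sum_fps_nth_eq[OF assms(1,2,4)] assms(3) by (simp add: coef_d_def exp_coef_def)

lemma sum_fps_nth_0:
  assumes "1 \<le> N"
  shows "(\<Sum>m\<le>K. \<tau> ^ m / fact m * fps_nth ((1 - coef_b_fps N a) ^ J * coef_b_fps N a ^ m) 0) = 1"
proof -
  have "fps_nth ((1 - coef_b_fps N a) ^ J * coef_b_fps N a ^ m) 0 = (if m = 0 then 1 else 0)" for m
    using assms by (simp add: coef_b_fps_def fps_power_zeroth)
  then have "(\<Sum>m\<le>K. \<tau> ^ m / fact m * fps_nth ((1 - coef_b_fps N a) ^ J * coef_b_fps N a ^ m) 0)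
      = (\<Sum>m\<le>K. if m = 0 then 1 else 0)"
    by (intro sum.cong refl) (simp only: mult_zero_right if_False mult_1_right split: if_split, simp)
  then show ?thesis by simp
qed

text \<open>At \<open>\<xi> = \<theta> * sqrt t\<close> every \<open>\<xi> ^ (2 * k)\<close> is
  \<open>\<tau> ^ k\<close>. Dividing by \<open>t ^ (n + J)\<close> turns \<open>n + J\<close> of
  these factors into \<open>\<theta>\<^sup>2\<close>; the rest are the \<open>\<tau> ^ m\<close> of
  the exponential series.\<close>

lemma poly_R_eq:
  assumes N: "1 \<le> N" and n: "N \<le> n" "n \<le> K" and t: "0 < t"
  shows "poly (poly_R N a J n) (\<theta> * sqrt t) / t ^ (n + J)
    = (- 1) ^ J * \<theta> ^ (2 * J) * \<theta> ^ (2 * n)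
      * (\<Sum>m\<le>K. (t * \<theta>\<^sup>2) ^ m / fact m
          * fps_nth ((1 - coef_b_fps N a) ^ J * coef_b_fps N a ^ m) n)"
proof -
  define \<tau> where "\<tau> = t * \<theta>\<^sup>2"
  have \<xi>: "(\<theta> * sqrt t) ^ (2 * k) = \<tau> ^ k" for k
    using t unfolding power_mult \<tau>_def by (simp add: power_mult_distrib mult.commute)
  have \<tau>n: "\<tau> ^ k = t ^ k * \<theta> ^ (2 * k)" for k
    unfolding \<tau>_def by (simp add: power_mult_distrib power_mult)
  have P: "poly (poly_P N a l) (\<theta> * sqrt t) = \<tau> ^ l * exp_coef N a l \<tau>" for l
    unfolding poly_P_def exp_coef_def poly_sum poly_monom \<xi> sum_distrib_left power_add
    by (simp add: mult_ac)
  have Q: "poly (poly_Q N a J n) (\<theta> * sqrt t) = \<tau> ^ n * (if n < 2 * N then 0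
      else \<Sum>(l1, l2) | N \<le> l1 \<and> N \<le> l2 \<and> l1 + l2 = n. coef_d N a J l1 * exp_coef N a l2 \<tau>)"
    unfolding poly_Q_def
    by (auto simp: poly_sum poly_monom \<xi> P sum_distrib_left power_add intro!: sum.cong)
  have "poly (poly_R N a J n) (\<theta> * sqrt t) = (- 1) ^ J * \<tau> ^ J * \<tau> ^ n
      * (\<Sum>m\<le>K. \<tau> ^ m / fact m * fps_nth ((1 - coef_b_fps N a) ^ J * coef_b_fps N a ^ m) n)"
    unfolding poly_R_def poly_mult poly_add poly_monom \<xi> P Q
    by (subst sum_fps_nth_eq) (use N n in \<open>simp_all add: algebra_simps\<close>)
  then show ?thesis
    using t unfolding \<tau>_def[symmetric] by (simp add: \<tau>n power_add)
qed

section \<open>Even expansions and the Gaussian approximation of the kernel\<close>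

text \<open>A Taylor expansion in \<open>\<theta>\<^sup>2\<close> whose remainder is controlled on
  the whole interval of integration, not only near 0. Recording the coefficients as a formal power
  series lets products and powers follow the algebra of \<open>real fps\<close>.\<close>

definition even_expansion :: "nat \<Rightarrow> (real \<Rightarrow> real) \<Rightarrow> real fps \<Rightarrow> bool" where
  "even_expansion K f F \<longleftrightarrow> (\<exists>C\<ge>0. \<forall>\<theta>. \<bar>\<theta>\<bar> \<le> pi \<longrightarrow>
     \<bar>f \<theta> - (\<Sum>n\<le>K. fps_nth F n * \<theta> ^ (2 * n))\<bar> \<le> C * \<theta> ^ (2 * (K + 1)))"

lemma poly_bounded_interval:
  obtains C where "0 \<le> C" "\<And>\<theta>::real. \<bar>\<theta>\<bar> \<le> pi \<Longrightarrow> \<bar>poly P (\<theta>\<^sup>2)\<bar> \<le> C"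
proof -
  have "compact ((\<lambda>\<theta>. poly P (\<theta>\<^sup>2)) ` {- pi..pi})"
    by (intro compact_continuous_image continuous_intros) simp
  then have "bounded ((\<lambda>\<theta>. poly P (\<theta>\<^sup>2)) ` {- pi..pi})" by (rule compact_imp_bounded)
  then obtain C where C: "\<forall>y\<in>(\<lambda>\<theta>. poly P (\<theta>\<^sup>2)) ` {- pi..pi}. norm y \<le> C"
    unfolding bounded_iff by blast
  have "\<bar>poly P (\<theta>\<^sup>2)\<bar> \<le> max C 0" if "\<bar>\<theta>\<bar> \<le> pi" for \<theta>
  proof -
    have "\<theta> \<in> {- pi..pi}" using that by (auto simp: abs_le_iff)
    then have "norm (poly P (\<theta>\<^sup>2)) \<le> C" using C by blast
    then show ?thesis by simp
  qed
  then show ?thesis by (intro that[of "max C 0"]) simp_all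
qed

text \<open>\<open>poly_shift (K + 1) P\<close> is the exact quotient of the tail by the power
  \<open>K + 1\<close>, and it is bounded on the interval.\<close>

lemma even_expansion_poly: "even_expansion K (\<lambda>\<theta>. poly P (\<theta>\<^sup>2)) (fps_of_poly P)"
proof -
  obtain C where C: "0 \<le> C" "\<And>\<theta>. \<bar>\<theta>\<bar> \<le> pi \<Longrightarrow> \<bar>poly (poly_shift (K + 1) P) (\<theta>\<^sup>2)\<bar> \<le> C"
    using poly_bounded_interval by blast
  have P: "P = (\<Sum>n\<le>K. monom (coeff P n) n) + monom 1 (K + 1) * poly_shift (K + 1) P"
    by (rule poly_eqI) (auto simp: coeff_sum coeff_monom_mult coeff_poly_shift not_le)
  have "\<bar>poly P (\<theta>\<^sup>2) - (\<Sum>n\<le>K. fps_nth (fps_of_poly P) n * \<theta> ^ (2 * n))\<bar>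
      \<le> C * \<theta> ^ (2 * (K + 1))" if "\<bar>\<theta>\<bar> \<le> pi" for \<theta>
  proof -
    have "poly P (\<theta>\<^sup>2) - (\<Sum>n\<le>K. fps_nth (fps_of_poly P) n * \<theta> ^ (2 * n))
        = poly (poly_shift (K + 1) P) (\<theta>\<^sup>2) * \<theta> ^ (2 * (K + 1))"
      unfolding power_mult by (subst P) (simp add: poly_sum poly_monom)
    moreover have nonneg: "0 \<le> \<theta> ^ (2 * (K + 1))" by (rule zero_le_even_power) simp
    ultimately show ?thesis
      using mult_right_mono[OF C(2)[OF that] nonneg]
      by (simp only: abs_mult abs_of_nonneg[OF nonneg])
  qed
  then show ?thesis unfolding even_expansion_def using C(1) by blast
qed

lemma even_expansion_poly_approx:
  assumes "even_expansion K f F"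
  obtains P C where "\<And>n. n \<le> K \<Longrightarrow> coeff P n = fps_nth F n" "0 \<le> C"
    "\<And>\<theta>. \<bar>\<theta>\<bar> \<le> pi \<Longrightarrow> \<bar>f \<theta> - poly P (\<theta>\<^sup>2)\<bar> \<le> C * \<theta> ^ (2 * (K + 1))"
proof -
  define P where "P = (\<Sum>n\<le>K. monom (fps_nth F n) n)"
  have "poly P (\<theta>\<^sup>2) = (\<Sum>n\<le>K. fps_nth F n * \<theta> ^ (2 * n))" for \<theta>
    unfolding P_def by (simp add: poly_sum poly_monom power_mult)
  moreover obtain C where "0 \<le> C" "\<And>\<theta>. \<bar>\<theta>\<bar> \<le> pi \<Longrightarrow>
      \<bar>f \<theta> - (\<Sum>n\<le>K. fps_nth F n * \<theta> ^ (2 * n))\<bar> \<le> C * \<theta> ^ (2 * (K + 1))"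
    using assms unfolding even_expansion_def by blast
  moreover have "coeff P n = fps_nth F n" if "n \<le> K" for n
    unfolding P_def using that by (simp add: coeff_sum)
  ultimately show ?thesis by (intro that[of P C]) simp_all
qed

text \<open>Both factors are replaced by polynomials, whose product is covered by
  \<open>even_expansion_poly\<close>; the replacement error is split as (f - P) g + P (g -
  Q).\<close>

lemma even_expansion_mult:
  assumes "even_expansion K f F" "even_expansion K g G"
  shows "even_expansion K (\<lambda>\<theta>. f \<theta> * g \<theta>) (F * G)"
proof -
  obtain P C where P: "\<And>n. n \<le> K \<Longrightarrow> coeff P n = fps_nth F n" "0 \<le> C"
    "\<And>\<theta>. \<bar>\<theta>\<bar> \<le> pi \<Longrightarrow> \<bar>f \<theta> - poly P (\<theta>\<^sup>2)\<bar> \<le> C * \<theta> ^ (2 * (K + 1))"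
    using even_expansion_poly_approx[OF assms(1)] by blast
  obtain Q D where Q: "\<And>n. n \<le> K \<Longrightarrow> coeff Q n = fps_nth G n" "0 \<le> D"
    "\<And>\<theta>. \<bar>\<theta>\<bar> \<le> pi \<Longrightarrow> \<bar>g \<theta> - poly Q (\<theta>\<^sup>2)\<bar> \<le> D * \<theta> ^ (2 * (K + 1))"
    using even_expansion_poly_approx[OF assms(2)] by blast
  obtain p where p: "0 \<le> p" "\<And>\<theta>. \<bar>\<theta>\<bar> \<le> pi \<Longrightarrow> \<bar>poly P (\<theta>\<^sup>2)\<bar> \<le> p"
    using poly_bounded_interval by blast
  obtain q where q: "0 \<le> q" "\<And>\<theta>. \<bar>\<theta>\<bar> \<le> pi \<Longrightarrow> \<bar>poly Q (\<theta>\<^sup>2)\<bar> \<le> q"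
    using poly_bounded_interval by blast
  obtain E where E: "0 \<le> E" "\<And>\<theta>. \<bar>\<theta>\<bar> \<le> pi \<Longrightarrow>
     \<bar>poly (P * Q) (\<theta>\<^sup>2) - (\<Sum>n\<le>K. fps_nth (fps_of_poly (P * Q)) n * \<theta> ^ (2 * n))\<bar>
       \<le> E * \<theta> ^ (2 * (K + 1))"
    using even_expansion_poly[of K "P * Q"] unfolding even_expansion_def by blast
  have FG: "fps_nth (fps_of_poly (P * Q)) n = fps_nth (F * G) n" if "n \<le> K" for n
    using that P(1) Q(1) by (simp add: coeff_mult fps_mult_nth atMost_atLeast0)
  have "\<bar>f \<theta> * g \<theta> - (\<Sum>n\<le>K. fps_nth (F * G) n * \<theta> ^ (2 * n))\<bar>
      \<le> (C * (q + D * pi ^ (2 * (K + 1))) + p * D + E) * \<theta> ^ (2 * (K + 1))" if \<theta>: "\<bar>\<theta>\<bar> \<le> pi" for \<theta>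
  proof -
    define y where "y = \<theta> ^ (2 * (K + 1))"
    have y: "0 \<le> y" "y \<le> pi ^ (2 * (K + 1))"
      unfolding y_def using power_mono[OF \<theta>, of "2 * (K + 1)"]
      by (simp_all add: zero_le_even_power power_even_abs del: mult_Suc_right)
    have "\<bar>g \<theta>\<bar> \<le> q + D * y" using Q(3)[OF \<theta>] q(2)[OF \<theta>] unfolding y_def by linarith
    also have "\<dots> \<le> q + D * pi ^ (2 * (K + 1))" using y Q(2) by (intro add_left_mono mult_left_mono)
    finally have "\<bar>(f \<theta> - poly P (\<theta>\<^sup>2)) * g \<theta>\<bar> \<le> (C * y) * (q + D * pi ^ (2 * (K + 1)))"
      unfolding abs_mult using P(3)[OF \<theta>] P(2) y(1) unfolding y_def[symmetric]
      by (intro mult_mono) auto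
    moreover have "\<bar>poly P (\<theta>\<^sup>2) * (g \<theta> - poly Q (\<theta>\<^sup>2))\<bar> \<le> p * (D * y)"
      unfolding abs_mult y_def using p Q(3) \<theta> by (intro mult_mono) auto
    moreover have "\<bar>poly P (\<theta>\<^sup>2) * poly Q (\<theta>\<^sup>2) - (\<Sum>n\<le>K. fps_nth (F * G) n * \<theta> ^ (2 * n))\<bar> \<le> E * y"
    proof -
      have "(\<Sum>n\<le>K. fps_nth (fps_of_poly (P * Q)) n * \<theta> ^ (2 * n))
          = (\<Sum>n\<le>K. fps_nth (F * G) n * \<theta> ^ (2 * n))"
        by (intro sum.cong refl) (simp only: FG atMost_iff)
      then show ?thesis using E(2)[OF \<theta>] unfolding y_def poly_mult by simp
    qed
    moreover have "\<bar>u * v - s\<bar> \<le> b + c + d"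
      if "\<bar>(u - p) * v\<bar> \<le> b" "\<bar>p * (v - q)\<bar> \<le> c" "\<bar>p * q - s\<bar> \<le> d" for u v p q s b c d :: real
      using that unfolding left_diff_distrib right_diff_distrib by linarith
    ultimately have "\<bar>f \<theta> * g \<theta> - (\<Sum>n\<le>K. fps_nth (F * G) n * \<theta> ^ (2 * n))\<bar>
        \<le> (C * y) * (q + D * pi ^ (2 * (K + 1))) + p * (D * y) + E * y"
      by blast
    also have "\<dots> = (C * (q + D * pi ^ (2 * (K + 1))) + p * D + E) * y"
      by (simp add: algebra_simps)
    finally show ?thesis unfolding y_def .
  qed
  moreover have "0 \<le> C * (q + D * pi ^ (2 * (K + 1))) + p * D + E"
    using P(2) Q(2) p(1) q(1) E(1) by (intro add_nonneg_nonneg mult_nonneg_nonneg) auto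
  ultimately show ?thesis unfolding even_expansion_def by blast
qed

lemma even_expansion_1: "even_expansion K (\<lambda>_. 1) 1"
  using even_expansion_poly[of K 1] by simp

lemma even_expansion_power:
  "even_expansion K f F \<Longrightarrow> even_expansion K (\<lambda>\<theta>. f \<theta> ^ m) (F ^ m)"
  by (induction m) (simp_all add: even_expansion_1 even_expansion_mult)

lemma even_expansion_diff:
  assumes "even_expansion K f F" "even_expansion K g G"
  shows "even_expansion K (\<lambda>\<theta>. f \<theta> - g \<theta>) (F - G)"
proof -
  obtain C D where "0 \<le> C" "0 \<le> D" and *:
    "\<And>\<theta>. \<bar>\<theta>\<bar> \<le> pi \<Longrightarrow> \<bar>f \<theta> - (\<Sum>n\<le>K. fps_nth F n * \<theta> ^ (2 * n))\<bar> \<le> C * \<theta> ^ (2 * (K + 1))"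
    "\<And>\<theta>. \<bar>\<theta>\<bar> \<le> pi \<Longrightarrow> \<bar>g \<theta> - (\<Sum>n\<le>K. fps_nth G n * \<theta> ^ (2 * n))\<bar> \<le> D * \<theta> ^ (2 * (K + 1))"
    using assms unfolding even_expansion_def by blast
  have "\<bar>f \<theta> - g \<theta> - (\<Sum>n\<le>K. fps_nth (F - G) n * \<theta> ^ (2 * n))\<bar> \<le> (C + D) * \<theta> ^ (2 * (K + 1))"
    if "\<bar>\<theta>\<bar> \<le> pi" for \<theta>
    using *[OF that] unfolding fps_sub_nth left_diff_distrib sum_subtractf distrib_right by linarith
  then show ?thesis
    unfolding even_expansion_def using \<open>0 \<le> C\<close> \<open>0 \<le> D\<close> by (intro exI[of _ "C + D"]) auto
qed

text \<open>The \<beta> of the overview. Under the moment conditions it tends to 0 at the origin,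
  whence the value there.\<close>

definition symbol_defect :: "nat \<Rightarrow> (nat \<Rightarrow> real) \<Rightarrow> real \<Rightarrow> real" where
  "symbol_defect N a \<theta> = (if \<theta> = 0 then 0 else 1 - symbol N a \<theta> / \<theta>\<^sup>2)"

lemma symbol_eq: "symbol N a \<theta> = \<theta>\<^sup>2 * (1 - symbol_defect N a \<theta>)"
  unfolding symbol_defect_def by (simp add: symbol_0)

lemma even_expansion_symbol_defect:
  assumes "1 \<le> N" "fd_coeffs N a"
  shows "even_expansion K (symbol_defect N a) (coef_b_fps N a)"
proof -
  obtain C where C: "0 \<le> C"
    "\<And>\<theta>. \<bar>symbol N a \<theta> + (\<Sum>n\<le>K. coef_b N a n * \<theta> ^ (2 * (n + 1)))\<bar> \<le> C * \<theta> ^ (2 * (K + 2))"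
    using symbol_Taylor by blast
  have "\<bar>symbol_defect N a \<theta> - (\<Sum>n\<le>K. fps_nth (coef_b_fps N a) n * \<theta> ^ (2 * n))\<bar>
      \<le> C * \<theta> ^ (2 * (K + 1))" for \<theta>
  proof (cases "\<theta> = 0")
    case True
    have "(\<Sum>n\<le>K. fps_nth (coef_b_fps N a) n * \<theta> ^ (2 * n)) = 0"
      using assms True by (intro sum.neutral) (auto simp: coef_b_fps_def power_0_left)
    then show ?thesis using True C(1) by (simp add: symbol_defect_def)
  next
    case False
    \<comment> \<open>The two coefficient sequences differ only by
      \<open>coef_b N a 0 = - 1\<close>, which accounts for the 1 in \<open>symbol_defect\<close>.
      Division by \<open>\<theta>\<^sup>2\<close> lowers the order of the remainder from
      \<open>K + 2\<close> to \<open>K + 1\<close>.\<close>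
    have "(\<Sum>n\<le>K. coef_b N a n * \<theta> ^ (2 * n))
        = (\<Sum>n\<le>K. fps_nth (coef_b_fps N a) n * \<theta> ^ (2 * n) - (if n = 0 then 1 else 0))"
      using assms coef_b_0[of N a] coef_b_eq_0[of N a]
      by (intro sum.cong refl) (auto simp: coef_b_fps_def Suc_le_eq not_le)
    then have b: "(\<Sum>n\<le>K. coef_b N a n * \<theta> ^ (2 * n))
        = (\<Sum>n\<le>K. fps_nth (coef_b_fps N a) n * \<theta> ^ (2 * n)) - 1"
      by (simp add: sum_subtractf)
    have "symbol N a \<theta> + (\<Sum>n\<le>K. coef_b N a n * \<theta> ^ (2 * (n + 1)))
        = \<theta>\<^sup>2 * (symbol N a \<theta> / \<theta>\<^sup>2 + (\<Sum>n\<le>K. coef_b N a n * \<theta> ^ (2 * n)))"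
      using False by (simp add: distrib_left sum_distrib_left power2_eq_square mult_ac)
    also have "\<dots> = - \<theta>\<^sup>2 * (symbol_defect N a \<theta> - (\<Sum>n\<le>K. fps_nth (coef_b_fps N a) n * \<theta> ^ (2 * n)))"
      using False unfolding b by (simp add: symbol_defect_def algebra_simps)
    finally have "\<theta>\<^sup>2 * \<bar>symbol_defect N a \<theta> - (\<Sum>n\<le>K. fps_nth (coef_b_fps N a) n * \<theta> ^ (2 * n))\<bar>
        \<le> \<theta>\<^sup>2 * (C * \<theta> ^ (2 * (K + 1)))"
      using C(2)[of \<theta>] by (simp add: abs_mult power2_eq_square mult_ac)
    then show ?thesis by (rule mult_left_le_imp_le) (use False in simp)
  qed
  then show ?thesis unfolding even_expansion_def using C(1) by blast
qed

section \<open>Exponential estimates and the error of the truncated kernel\<close>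

lemma abs_exp_minus_Taylor_le:
  fixes z :: real
  shows "\<bar>exp z - (\<Sum>m\<le>K. z ^ m / fact m)\<bar> \<le> \<bar>z\<bar> ^ (K + 1) * max 1 (exp z)"
proof -
  \<comment> \<open>The intermediate point is at most the larger of 0 and \<open>z\<close>. Bounding
    by \<open>max 1 (exp z)\<close> treats both signs of \<open>symbol_defect\<close> at
    once.\<close>
  obtain s where s: "s \<le> max 0 z"
    "exp z = (\<Sum>m<Suc K. z ^ m / fact m) + exp s / fact (Suc K) * z ^ Suc K"
  proof (cases "z < 0")
    case True
    have "\<exists>t>z. t < 0 \<and> exp z = (\<Sum>m<Suc K. exp 0 / fact m * z ^ m) + exp t / fact (Suc K) * z ^ Suc K"
      by (rule Maclaurin_minus[OF True, of "Suc K" "\<lambda>_. exp" exp]) auto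
    then show ?thesis using that by auto
  next
    case False
    obtain t where "\<bar>t\<bar> \<le> \<bar>z\<bar>"
      "exp z = (\<Sum>m<Suc K. z ^ m / fact m) + exp t / fact (Suc K) * z ^ Suc K"
      using Maclaurin_exp_le[of z "Suc K"] by blast
    then show ?thesis using that[of t] False by auto
  qed
  have "\<bar>exp z - (\<Sum>m\<le>K. z ^ m / fact m)\<bar> = \<bar>z\<bar> ^ Suc K * (exp s / fact (Suc K))"
    unfolding s(2) lessThan_Suc_atMost by (simp add: abs_mult power_abs)
  also have "\<dots> \<le> \<bar>z\<bar> ^ Suc K * max 1 (exp z)"
  proof (rule mult_left_mono)
    have "exp s / fact (Suc K) \<le> exp s"
      using fact_ge_1[of "Suc K", where 'a = real] by (simp add: divide_le_eq del: fact_Suc)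
    also have "\<dots> \<le> exp (max 0 z)" using s(1) by simp
    also have "\<dots> = max 1 (exp z)" by (auto simp: max_def)
    finally show "exp s / fact (Suc K) \<le> max 1 (exp z)" .
  qed simp
  finally show ?thesis by simp
qed

lemma power_le_fact_exp:
  fixes x :: real assumes "0 \<le> x" shows "x ^ n \<le> fact n * exp x"
proof -
  obtain t where "exp x = (\<Sum>m<Suc n. x ^ m / fact m) + exp t / fact (Suc n) * x ^ Suc n"
    using Maclaurin_exp_le[of x "Suc n"] by blast
  moreover have "x ^ n / fact n \<le> (\<Sum>m<Suc n. x ^ m / fact m)"
    using assms by (intro member_le_sum) auto
  moreover have "0 \<le> exp t / fact (Suc n) * x ^ Suc n"
    using assms by (intro mult_nonneg_nonneg divide_nonneg_nonneg) auto
  ultimately have "x ^ n / fact n \<le> exp x" by linarith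
  then show ?thesis by (simp add: divide_le_eq mult.commute)
qed

text \<open>Half of the decay rate is spent on the polynomial:
  \<open>x ^ m \<le> fact m * exp x\<close> at \<open>x = c / 2 * \<tau>\<close> is the origin of
  \<open>fact m * (2 / c) ^ m\<close>.\<close>

lemma sum_power_exp_le:
  fixes w :: "nat \<Rightarrow> real"
  assumes "0 < c"
  obtains M where "0 \<le> M"
    "\<And>\<tau>. 0 \<le> \<tau> \<Longrightarrow> (\<Sum>m\<le>L. \<bar>w m\<bar> * \<tau> ^ m) * exp (- c * \<tau>) \<le> M * exp (- (c / 2) * \<tau>)"
proof
  define M where "M = (\<Sum>m\<le>L. \<bar>w m\<bar> * (fact m * (2 / c) ^ m))"
  show "0 \<le> M" unfolding M_def using assms by (intro sum_nonneg) auto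
  fix \<tau> :: real assume \<tau>: "0 \<le> \<tau>"
  have "\<tau> ^ m \<le> (fact m * (2 / c) ^ m) * exp (c / 2 * \<tau>)" for m
  proof -
    have "\<tau> ^ m = (2 / c) ^ m * (c / 2 * \<tau>) ^ m"
      using assms by (simp flip: power_mult_distrib)
    also have "\<dots> \<le> (2 / c) ^ m * (fact m * exp (c / 2 * \<tau>))"
      using assms \<tau> by (intro mult_left_mono power_le_fact_exp) auto
    finally show ?thesis by (simp add: mult_ac)
  qed
  then have "(\<Sum>m\<le>L. \<bar>w m\<bar> * \<tau> ^ m) \<le> (\<Sum>m\<le>L. \<bar>w m\<bar> * ((fact m * (2 / c) ^ m) * exp (c / 2 * \<tau>)))"
    by (intro sum_mono mult_left_mono) auto
  also have "\<dots> = M * exp (c / 2 * \<tau>)" unfolding M_def sum_distrib_right by (simp add: mult.assoc)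
  finally have "(\<Sum>m\<le>L. \<bar>w m\<bar> * \<tau> ^ m) * exp (- c * \<tau>) \<le> M * exp (c / 2 * \<tau>) * exp (- c * \<tau>)"
    by (intro mult_right_mono) auto
  also have "\<dots> = M * exp (- (c / 2) * \<tau>)"
    by (simp add: mult.assoc flip: exp_add)
  finally show "(\<Sum>m\<le>L. \<bar>w m\<bar> * \<tau> ^ m) * exp (- c * \<tau>) \<le> M * exp (- (c / 2) * \<tau>)" .
qed

text \<open>Double truncation of
  \<open>(1 - \<beta> \<theta>) ^ J * exp (\<tau> * \<beta> \<theta>)\<close> with
  \<open>\<tau>\<close> and \<open>\<theta>\<close> as independent variables: \<open>m\<close>
  counts the terms of the exponential series, \<open>n\<close> the powers of
  \<open>\<theta>\<^sup>2\<close>.\<close>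

definition truncated_factor :: "nat \<Rightarrow> (nat \<Rightarrow> real) \<Rightarrow> nat \<Rightarrow> nat \<Rightarrow> real \<Rightarrow> real \<Rightarrow> real" where
  "truncated_factor N a J K \<tau> \<theta> = (\<Sum>m\<le>K. \<tau> ^ m / fact m
     * (\<Sum>n\<le>K. fps_nth ((1 - coef_b_fps N a) ^ J * coef_b_fps N a ^ m) n * \<theta> ^ (2 * n)))"

text \<open>Outside the interval the expansion is compared with zero, so all of it counts as error.
  There \<open>\<bar>\<theta>\<bar>\<close> exceeds 1 and \<open>\<theta> ^ (2 * (K + 1))\<close>
  absorbs the lower powers, so the tail obeys the same kind of bound as the interior error.\<close>

lemma truncated_factor_far:
  obtains w where "\<And>\<tau> \<theta>. 0 \<le> \<tau> \<Longrightarrow> pi \<le> \<bar>\<theta>\<bar> \<Longrightarrow>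
    \<bar>truncated_factor N a J K \<tau> \<theta>\<bar> \<le> (\<Sum>m\<le>K. \<bar>w m\<bar> * \<tau> ^ m) * \<theta> ^ (2 * (K + 1))"
proof -
  define c where "c = (\<lambda>m n. fps_nth ((1 - coef_b_fps N a) ^ J * coef_b_fps N a ^ m) n)"
  have c: "fps_nth ((1 - coef_b_fps N a) ^ J * coef_b_fps N a ^ m) n = c m n" for m n
    unfolding c_def ..
  define w where "w = (\<lambda>m. \<Sum>n\<le>K. \<bar>c m n\<bar>)"
  have "\<bar>truncated_factor N a J K \<tau> \<theta>\<bar> \<le> (\<Sum>m\<le>K. \<bar>w m\<bar> * \<tau> ^ m) * \<theta> ^ (2 * (K + 1))"
    if \<tau>: "0 \<le> \<tau>" and \<theta>: "pi \<le> \<bar>\<theta>\<bar>" for \<tau> \<theta>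
  proof -
  have "\<theta> ^ (2 * n) \<le> \<theta> ^ (2 * (K + 1))" if "n \<le> K" for n
  proof -
    have "\<bar>\<theta>\<bar> ^ (2 * n) \<le> \<bar>\<theta>\<bar> ^ (2 * (K + 1))"
      using \<theta> pi_ge_two that by (intro power_increasing) auto
    then show ?thesis by (simp add: power_even_abs)
  qed
  then have S: "\<bar>\<Sum>n\<le>K. c m n * \<theta> ^ (2 * n)\<bar> \<le> w m * \<theta> ^ (2 * (K + 1))" for m
    unfolding w_def sum_distrib_right
    by (intro order_trans[OF sum_abs] sum_mono) (auto simp: abs_mult power_even_abs intro!: mult_left_mono)
  have "\<bar>truncated_factor N a J K \<tau> \<theta>\<bar> \<le> (\<Sum>m\<le>K. \<tau> ^ m * (w m * \<theta> ^ (2 * (K + 1))))"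
    unfolding truncated_factor_def c
  proof (intro order_trans[OF sum_abs] sum_mono)
    fix m
    have "\<tau> ^ m / fact m \<le> \<tau> ^ m"
      using mult_left_mono[OF fact_ge_1[of m], of "\<tau> ^ m"] \<tau> by (simp add: divide_le_eq)
    then show "\<bar>\<tau> ^ m / fact m * (\<Sum>n\<le>K. c m n * \<theta> ^ (2 * n))\<bar> \<le> \<tau> ^ m * (w m * \<theta> ^ (2 * (K + 1)))"
      unfolding abs_mult using S[of m] \<tau> by (intro mult_mono) auto
  qed
  also have "\<dots> = (\<Sum>m\<le>K. \<bar>w m\<bar> * \<tau> ^ m) * \<theta> ^ (2 * (K + 1))"
  proof -
    have "\<bar>w m\<bar> = w m" for m unfolding w_def by (intro abs_of_nonneg sum_nonneg) simp
    then show ?thesis unfolding sum_distrib_right by (simp only: mult_ac)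
  qed
  finally show ?thesis .
  qed
  then show ?thesis using that by blast
qed

lemma truncated_factor_near:
  assumes "1 \<le> N" "fd_coeffs N a"
  defines "\<beta> \<equiv> symbol_defect N a"
  obtains w where "\<And>\<tau> \<theta>. 0 \<le> \<tau> \<Longrightarrow> \<bar>\<theta>\<bar> \<le> pi \<Longrightarrow>
    \<bar>(1 - \<beta> \<theta>) ^ J * exp (\<tau> * \<beta> \<theta>) - truncated_factor N a J K \<tau> \<theta>\<bar>
      \<le> (\<Sum>m\<le>K + 1. \<bar>w m\<bar> * \<tau> ^ m) * max 1 (exp (\<tau> * \<beta> \<theta>)) * \<theta> ^ (2 * (K + 1))"
proof -
  define B where "B = coef_b_fps N a"
  have exp\<beta>: "even_expansion L \<beta> B" for L
    unfolding \<beta>_def B_def by (rule even_expansion_symbol_defect[OF assms(1,2)])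
  have "even_expansion K (\<lambda>\<theta>. (1 - \<beta> \<theta>) ^ J * \<beta> \<theta> ^ m) ((1 - B) ^ J * B ^ m)" for m
    by (intro even_expansion_mult even_expansion_power even_expansion_diff even_expansion_1 exp\<beta>)
  then have "\<forall>m. \<exists>C. 0 \<le> C \<and> (\<forall>\<theta>. \<bar>\<theta>\<bar> \<le> pi \<longrightarrow> \<bar>(1 - \<beta> \<theta>) ^ J * \<beta> \<theta> ^ m
      - (\<Sum>n\<le>K. fps_nth ((1 - B) ^ J * B ^ m) n * \<theta> ^ (2 * n))\<bar> \<le> C * \<theta> ^ (2 * (K + 1)))"
    unfolding even_expansion_def by (rule allI)
  from choice[OF this] obtain C where "\<forall>m. 0 \<le> C m \<and> (\<forall>\<theta>. \<bar>\<theta>\<bar> \<le> pi \<longrightarrow> \<bar>(1 - \<beta> \<theta>) ^ J * \<beta> \<theta> ^ m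
      - (\<Sum>n\<le>K. fps_nth ((1 - B) ^ J * B ^ m) n * \<theta> ^ (2 * n))\<bar> \<le> C m * \<theta> ^ (2 * (K + 1)))"
    by (elim exE)
  then have C: "\<And>m. 0 \<le> C m" "\<And>m \<theta>. \<bar>\<theta>\<bar> \<le> pi \<Longrightarrow> \<bar>(1 - \<beta> \<theta>) ^ J * \<beta> \<theta> ^ m
      - (\<Sum>n\<le>K. fps_nth ((1 - B) ^ J * B ^ m) n * \<theta> ^ (2 * n))\<bar> \<le> C m * \<theta> ^ (2 * (K + 1))"
    by simp_all
  \<comment> \<open>The expansion of order 0, whose only coefficient vanishes, says that
    \<open>\<beta> \<theta>\<close> is O(\<open>\<theta>\<^sup>2\<close>).\<close>
  obtain D where D: "0 \<le> D" "\<And>\<theta>. \<bar>\<theta>\<bar> \<le> pi \<Longrightarrow> \<bar>\<beta> \<theta>\<bar> \<le> D * \<theta>\<^sup>2"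
    using exp\<beta>[of 0] assms(1) unfolding even_expansion_def
    by (auto simp: B_def coef_b_fps_def power2_eq_square)
  define E where "E = (1 + D * pi\<^sup>2) ^ J * D ^ (K + 1)"
  have E: "0 \<le> E" unfolding E_def using D(1) by (intro mult_nonneg_nonneg zero_le_power) auto
  \<comment> \<open>Index \<open>K + 1\<close> holds the remainder of the exponential series, which
    brings \<open>\<tau> ^ (K + 1)\<close>; smaller indices hold the errors of expanding
    \<open>(1 - \<beta> \<theta>) ^ J * \<beta> \<theta> ^ m\<close>.\<close>
  define w where "w = (\<lambda>m. if m \<le> K then C m else E)"
  have "\<bar>(1 - \<beta> \<theta>) ^ J * exp (\<tau> * \<beta> \<theta>) - truncated_factor N a J K \<tau> \<theta>\<bar>
      \<le> (\<Sum>m\<le>K + 1. \<bar>w m\<bar> * \<tau> ^ m) * max 1 (exp (\<tau> * \<beta> \<theta>)) * \<theta> ^ (2 * (K + 1))"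
    if \<tau>: "0 \<le> \<tau>" and \<theta>: "\<bar>\<theta>\<bar> \<le> pi" for \<tau> \<theta>
  proof -
    define X where "X = max 1 (exp (\<tau> * \<beta> \<theta>))"
    define Y where "Y = \<theta> ^ (2 * (K + 1))"
    have X: "1 \<le> X" unfolding X_def by simp
    have Y: "0 \<le> Y" unfolding Y_def by (rule zero_le_even_power) simp
    define S where "S = (\<Sum>m\<le>K. (\<tau> * \<beta> \<theta>) ^ m / fact m)"
    have "\<bar>(1 - \<beta> \<theta>) ^ J * (exp (\<tau> * \<beta> \<theta>) - S)\<bar> \<le> E * \<tau> ^ (K + 1) * X * Y"
    proof -
      have "\<theta>\<^sup>2 \<le> pi\<^sup>2" using \<theta> by (metis abs_ge_zero power2_abs power_mono)
      then have "\<bar>1 - \<beta> \<theta>\<bar> \<le> 1 + D * pi\<^sup>2"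
        using D(2)[OF \<theta>] mult_left_mono[OF _ D(1), of "\<theta>\<^sup>2" "pi\<^sup>2"] by linarith
      then have "\<bar>(1 - \<beta> \<theta>) ^ J\<bar> \<le> (1 + D * pi\<^sup>2) ^ J" unfolding power_abs by (intro power_mono) auto
      moreover have "\<bar>exp (\<tau> * \<beta> \<theta>) - S\<bar> \<le> (\<tau> * (D * \<theta>\<^sup>2)) ^ (K + 1) * X"
      proof -
        have "\<bar>\<tau> * \<beta> \<theta>\<bar> ^ (K + 1) \<le> (\<tau> * (D * \<theta>\<^sup>2)) ^ (K + 1)"
          using D(2)[OF \<theta>] \<tau> by (intro power_mono) (auto simp: abs_mult intro!: mult_left_mono)
        then have "\<bar>\<tau> * \<beta> \<theta>\<bar> ^ (K + 1) * X \<le> (\<tau> * (D * \<theta>\<^sup>2)) ^ (K + 1) * X"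
          using X by (intro mult_right_mono) auto
        then show ?thesis
          using abs_exp_minus_Taylor_le[of "\<tau> * \<beta> \<theta>" K] unfolding S_def X_def by linarith
      qed
      ultimately have "\<bar>(1 - \<beta> \<theta>) ^ J * (exp (\<tau> * \<beta> \<theta>) - S)\<bar>
          \<le> (1 + D * pi\<^sup>2) ^ J * ((\<tau> * (D * \<theta>\<^sup>2)) ^ (K + 1) * X)"
        unfolding abs_mult using D(1) by (intro mult_mono) auto
      also have "\<dots> = E * \<tau> ^ (K + 1) * X * Y"
        unfolding E_def Y_def power_mult_distrib power_mult by (simp only: mult_ac)
      finally show ?thesis .
    qed
    moreover have "\<bar>(1 - \<beta> \<theta>) ^ J * S - truncated_factor N a J K \<tau> \<theta>\<bar> \<le> (\<Sum>m\<le>K. C m * \<tau> ^ m) * X * Y"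
    proof -
      have "(1 - \<beta> \<theta>) ^ J * S - truncated_factor N a J K \<tau> \<theta>
          = (\<Sum>m\<le>K. \<tau> ^ m / fact m * ((1 - \<beta> \<theta>) ^ J * \<beta> \<theta> ^ m
              - (\<Sum>n\<le>K. fps_nth ((1 - B) ^ J * B ^ m) n * \<theta> ^ (2 * n))))"
        unfolding S_def truncated_factor_def B_def right_diff_distrib sum_subtractf
          sum_distrib_left[of "(1 - \<beta> \<theta>) ^ J"]
        by (simp add: power_mult_distrib mult_ac)
      also have "\<bar>\<dots>\<bar> \<le> (\<Sum>m\<le>K. \<tau> ^ m * (C m * Y))"
      proof (intro order_trans[OF sum_abs] sum_mono)
        fix m
        have "\<tau> ^ m / fact m \<le> \<tau> ^ m"
          using mult_left_mono[OF fact_ge_1[of m], of "\<tau> ^ m"] \<tau> by (simp add: divide_le_eq)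
        then show "\<bar>\<tau> ^ m / fact m * ((1 - \<beta> \<theta>) ^ J * \<beta> \<theta> ^ m
            - (\<Sum>n\<le>K. fps_nth ((1 - B) ^ J * B ^ m) n * \<theta> ^ (2 * n)))\<bar> \<le> \<tau> ^ m * (C m * Y)"
          unfolding abs_mult Y_def using C(2)[OF \<theta>, of m] \<tau> by (intro mult_mono) auto
      qed
      also have "\<dots> = (\<Sum>m\<le>K. C m * \<tau> ^ m) * 1 * Y"
        unfolding sum_distrib_right by (simp add: mult_ac)
      also have "\<dots> \<le> (\<Sum>m\<le>K. C m * \<tau> ^ m) * X * Y"
        using X Y C(1) \<tau> by (intro mult_right_mono mult_left_mono sum_nonneg) auto
      finally show ?thesis .
    qed
    moreover have "(1 - \<beta> \<theta>) ^ J * exp (\<tau> * \<beta> \<theta>)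
        = (1 - \<beta> \<theta>) ^ J * (exp (\<tau> * \<beta> \<theta>) - S) + (1 - \<beta> \<theta>) ^ J * S"
      by (simp add: right_diff_distrib)
    ultimately have "\<bar>(1 - \<beta> \<theta>) ^ J * exp (\<tau> * \<beta> \<theta>) - truncated_factor N a J K \<tau> \<theta>\<bar>
        \<le> E * \<tau> ^ (K + 1) * X * Y + (\<Sum>m\<le>K. C m * \<tau> ^ m) * X * Y"
      by linarith
    also have "\<dots> = (\<Sum>m\<le>K + 1. \<bar>w m\<bar> * \<tau> ^ m) * X * Y"
    proof -
      have "(\<Sum>m\<le>K + 1. \<bar>w m\<bar> * \<tau> ^ m) = (\<Sum>m\<le>K. C m * \<tau> ^ m) + E * \<tau> ^ (K + 1)"
        unfolding w_def using C(1) E by simp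
      then show ?thesis by (simp only: distrib_right add.commute)
    qed
    finally show ?thesis unfolding X_def Y_def .
  qed
  then show ?thesis using that by blast
qed

definition symbol_kernel :: "nat \<Rightarrow> (nat \<Rightarrow> real) \<Rightarrow> nat \<Rightarrow> real \<Rightarrow> real \<Rightarrow> real" where
  "symbol_kernel N a J t \<theta> = (- symbol N a \<theta>) ^ J * exp (- t * symbol N a \<theta>)"

definition gauss_kernel :: "nat \<Rightarrow> (nat \<Rightarrow> real) \<Rightarrow> nat \<Rightarrow> nat \<Rightarrow> real \<Rightarrow> real \<Rightarrow> real" where
  "gauss_kernel N a J K t \<theta> =
     (- 1) ^ J * \<theta> ^ (2 * J) * exp (- t * \<theta>\<^sup>2) * truncated_factor N a J K (t * \<theta>\<^sup>2) \<theta>"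

lemma kernel_approximation:
  assumes "1 \<le> N" "fd_coeffs N a"
  obtains C \<kappa> where "0 \<le> C" "0 < \<kappa>" "\<And>t \<theta>. 0 \<le> t \<Longrightarrow>
    \<bar>indicator {- pi..pi} \<theta> * symbol_kernel N a J t \<theta> - gauss_kernel N a J K t \<theta>\<bar>
      \<le> C * (exp (- \<kappa> * (t * \<theta>\<^sup>2)) * \<theta> ^ (2 * (J + K + 1)))"
proof -
  obtain c where c: "0 < c" "c \<le> 1" "\<And>\<theta>. \<bar>\<theta>\<bar> \<le> pi \<Longrightarrow> c * \<theta>\<^sup>2 \<le> symbol N a \<theta>"
    using symbol_lower_bound[OF assms(2)] by blast
  obtain w where w: "\<And>\<tau> \<theta>. 0 \<le> \<tau> \<Longrightarrow> pi \<le> \<bar>\<theta>\<bar> \<Longrightarrow>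
    \<bar>truncated_factor N a J K \<tau> \<theta>\<bar> \<le> (\<Sum>m\<le>K. \<bar>w m\<bar> * \<tau> ^ m) * \<theta> ^ (2 * (K + 1))"
    using truncated_factor_far by blast
  define \<beta> where "\<beta> = symbol_defect N a"
  obtain v where v: "\<And>\<tau> \<theta>. 0 \<le> \<tau> \<Longrightarrow> \<bar>\<theta>\<bar> \<le> pi \<Longrightarrow>
    \<bar>(1 - \<beta> \<theta>) ^ J * exp (\<tau> * \<beta> \<theta>) - truncated_factor N a J K \<tau> \<theta>\<bar>
      \<le> (\<Sum>m\<le>K + 1. \<bar>v m\<bar> * \<tau> ^ m) * max 1 (exp (\<tau> * \<beta> \<theta>)) * \<theta> ^ (2 * (K + 1))"
    using truncated_factor_near[OF assms] unfolding \<beta>_def by blast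
  obtain M where M: "0 \<le> M"
    "\<And>\<tau>. 0 \<le> \<tau> \<Longrightarrow> (\<Sum>m\<le>K. \<bar>w m\<bar> * \<tau> ^ m) * exp (- c * \<tau>) \<le> M * exp (- (c / 2) * \<tau>)"
    using sum_power_exp_le[OF c(1)] by blast
  obtain L where L: "0 \<le> L"
    "\<And>\<tau>. 0 \<le> \<tau> \<Longrightarrow> (\<Sum>m\<le>K + 1. \<bar>v m\<bar> * \<tau> ^ m) * exp (- c * \<tau>) \<le> L * exp (- (c / 2) * \<tau>)"
    using sum_power_exp_le[OF c(1)] by blast
  have "\<bar>indicator {- pi..pi} \<theta> * symbol_kernel N a J t \<theta> - gauss_kernel N a J K t \<theta>\<bar>
      \<le> max L M * (exp (- (c / 2) * (t * \<theta>\<^sup>2)) * \<theta> ^ (2 * (J + K + 1)))" if "0 \<le> t" for t \<theta>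
  proof -
    define \<tau> where "\<tau> = t * \<theta>\<^sup>2"
    have \<tau>: "0 \<le> \<tau>" unfolding \<tau>_def using that by simp
    define Y where "Y = \<theta> ^ (2 * (K + 1))"
    define Z where "Z = \<theta> ^ (2 * J)"
    have Y: "0 \<le> Y" "0 \<le> Z" unfolding Y_def Z_def by (rule zero_le_even_power, simp)+
    have c\<tau>: "exp (- \<tau>) \<le> exp (- c * \<tau>)" using c(2) \<tau> mult_right_mono[of c 1 \<tau>] by simp
    have YZ: "\<theta> ^ (2 * (J + K + 1)) = Z * Y" unfolding Y_def Z_def
      by (simp add: add_mult_distrib2 flip: power_add)
    have gauss: "gauss_kernel N a J K t \<theta> = (- 1) ^ J * (Z * (exp (- \<tau>) * truncated_factor N a J K \<tau> \<theta>))"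
      unfolding gauss_kernel_def \<tau>_def Z_def by (simp add: mult.assoc)
    show ?thesis
    proof (cases "\<bar>\<theta>\<bar> \<le> pi")
      case True
      have kernel: "symbol_kernel N a J t \<theta> = (- 1) ^ J * (Z * (exp (- \<tau>) * ((1 - \<beta> \<theta>) ^ J * exp (\<tau> * \<beta> \<theta>))))"
      proof -
        have "(- symbol N a \<theta>) ^ J = (- 1) ^ J * Z * (1 - \<beta> \<theta>) ^ J"
          unfolding symbol_eq \<beta>_def[symmetric] Z_def power_mult power_minus[of "_ * _"] power_mult_distrib
          by simp
        moreover have "exp (- t * symbol N a \<theta>) = exp (- \<tau>) * exp (\<tau> * \<beta> \<theta>)"
          unfolding symbol_eq \<beta>_def[symmetric] \<tau>_def exp_add[symmetric] by (simp add: algebra_simps)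
        ultimately show ?thesis unfolding symbol_kernel_def by (simp add: mult_ac)
      qed
      \<comment> \<open>\<open>exp (- \<tau>) * exp (\<tau> * \<beta> \<theta>)\<close> is
        \<open>exp (- t * symbol N a \<theta>)\<close>, to which the quadratic lower bound applies;
        the alternative 1 in the maximum is the reason for \<open>c \<le> 1\<close>.\<close>
      have small: "exp (- \<tau>) * max 1 (exp (\<tau> * \<beta> \<theta>)) \<le> exp (- c * \<tau>)"
      proof -
        have "c * \<tau> \<le> t * symbol N a \<theta>"
          unfolding \<tau>_def using mult_left_mono[OF c(3)[OF True] that] by (simp add: mult_ac)
        also have "\<dots> = \<tau> - \<tau> * \<beta> \<theta>"
          unfolding \<tau>_def symbol_eq \<beta>_def by (simp add: algebra_simps)
        finally have "exp (- \<tau>) * exp (\<tau> * \<beta> \<theta>) \<le> exp (- c * \<tau>)" unfolding exp_add[symmetric] by simp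
        then show ?thesis using c\<tau> by (simp add: max_def)
      qed
      have "indicator {- pi..pi} \<theta> = (1 :: real)"
        using True by (auto simp: indicator_def abs_le_iff)
      then have "indicator {- pi..pi} \<theta> * symbol_kernel N a J t \<theta> - gauss_kernel N a J K t \<theta>
          = (- 1) ^ J * (Z * (exp (- \<tau>) * ((1 - \<beta> \<theta>) ^ J * exp (\<tau> * \<beta> \<theta>) - truncated_factor N a J K \<tau> \<theta>)))"
        unfolding kernel gauss by (simp only: mult_1_left right_diff_distrib)
      then have "\<bar>indicator {- pi..pi} \<theta> * symbol_kernel N a J t \<theta> - gauss_kernel N a J K t \<theta>\<bar>
          = Z * (exp (- \<tau>) * \<bar>(1 - \<beta> \<theta>) ^ J * exp (\<tau> * \<beta> \<theta>) - truncated_factor N a J K \<tau> \<theta>\<bar>)"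
        using Y by (simp add: abs_mult power_abs)
      also have "\<dots> \<le> Z * (exp (- \<tau>) * ((\<Sum>m\<le>K + 1. \<bar>v m\<bar> * \<tau> ^ m) * max 1 (exp (\<tau> * \<beta> \<theta>)) * Y))"
        unfolding Y_def using v[OF \<tau> True] Y by (intro mult_left_mono) auto
      also have "\<dots> = (\<Sum>m\<le>K + 1. \<bar>v m\<bar> * \<tau> ^ m) * (exp (- \<tau>) * max 1 (exp (\<tau> * \<beta> \<theta>))) * (Z * Y)"
        by (simp only: mult_ac)
      also have "\<dots> \<le> (\<Sum>m\<le>K + 1. \<bar>v m\<bar> * \<tau> ^ m) * exp (- c * \<tau>) * (Z * Y)"
        using small Y \<tau> by (intro mult_right_mono mult_left_mono sum_nonneg mult_nonneg_nonneg) auto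
      also have "\<dots> \<le> (L * exp (- (c / 2) * \<tau>)) * (Z * Y)"
        using L(2)[OF \<tau>] Y by (intro mult_right_mono) auto
      also have "\<dots> \<le> (max L M * exp (- (c / 2) * \<tau>)) * (Z * Y)"
        using Y by (intro mult_right_mono) auto
      finally show ?thesis unfolding YZ \<tau>_def by (simp add: mult.assoc)
    next
      case False
      then have "indicator {- pi..pi} \<theta> = (0 :: real)" by (auto simp: indicator_def abs_le_iff)
      then have "\<bar>indicator {- pi..pi} \<theta> * symbol_kernel N a J t \<theta> - gauss_kernel N a J K t \<theta>\<bar>
          = Z * (exp (- \<tau>) * \<bar>truncated_factor N a J K \<tau> \<theta>\<bar>)"
        unfolding gauss using Y by (simp add: abs_mult power_abs)
      also have "\<dots> \<le> Z * (exp (- c * \<tau>) * ((\<Sum>m\<le>K. \<bar>w m\<bar> * \<tau> ^ m) * Y))"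
        unfolding Y_def using w[OF \<tau>, of \<theta>] Y c\<tau> False by (intro mult_left_mono mult_mono) auto
      also have "\<dots> = ((\<Sum>m\<le>K. \<bar>w m\<bar> * \<tau> ^ m) * exp (- c * \<tau>)) * (Z * Y)"
        by (simp only: mult_ac)
      also have "\<dots> \<le> (M * exp (- (c / 2) * \<tau>)) * (Z * Y)"
        using M(2)[OF \<tau>] Y by (intro mult_right_mono) auto
      also have "\<dots> \<le> (max L M * exp (- (c / 2) * \<tau>)) * (Z * Y)"
        using Y by (intro mult_right_mono) auto
      finally show ?thesis unfolding YZ \<tau>_def by (simp add: mult.assoc)
    qed
  qed
  then show ?thesis using that[of "max L M" "c / 2"] L(1) c(1) by auto
qed

section \<open>Gaussian Fourier integrals and the profiles\<close>

lemma integrable_gauss_moment: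
  assumes "0 < \<kappa>"
  shows "integrable lborel (\<lambda>x::real. exp (- \<kappa> * x\<^sup>2) * x ^ k)"
proof -
  \<comment> \<open>The normal density of variance \<open>1 / (2 * \<kappa>)\<close> is proportional
    to \<open>exp (- \<kappa> * x\<^sup>2)\<close>.\<close>
  define \<sigma> where "\<sigma> = sqrt (1 / (2 * \<kappa>))"
  have \<sigma>: "0 < \<sigma>" "\<sigma>\<^sup>2 = 1 / (2 * \<kappa>)" unfolding \<sigma>_def using assms by auto
  have "integrable lborel (\<lambda>x. sqrt (2 * pi * \<sigma>\<^sup>2) * (normal_density 0 \<sigma> x * (x - 0) ^ k))"
    by (intro integrable_mult_right integrable_normal_moment[OF \<sigma>(1)])
  moreover have "sqrt (2 * pi * \<sigma>\<^sup>2) * (normal_density 0 \<sigma> x * (x - 0) ^ k) = exp (- \<kappa> * x\<^sup>2) * x ^ k" for x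
    unfolding normal_density_def \<sigma>(2) using assms by (simp add: field_simps)
  ultimately show ?thesis by (simp only:)
qed

lemma borel_measurable_real_poly [measurable]: "poly (p :: real poly) \<in> borel_measurable borel"
  by (intro borel_measurable_continuous_onI continuous_intros)

lemma integrable_gauss_poly:
  assumes "0 < \<kappa>"
  shows "integrable lborel (\<lambda>x. complex_of_real (exp (- \<kappa> * x\<^sup>2) * poly p x) * iexp (x * y))"
proof -
  have "integrable lborel (\<lambda>x. \<Sum>k\<le>degree p. coeff p k * (exp (- \<kappa> * x\<^sup>2) * x ^ k))"
    by (intro Bochner_Integration.integrable_sum integrable_mult_right integrable_gauss_moment assms)
  then have "integrable lborel (\<lambda>x. exp (- \<kappa> * x\<^sup>2) * poly p x)"
    unfolding poly_altdef sum_distrib_left by (simp add: mult_ac)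
  then show ?thesis
    by (rule Bochner_Integration.integrable_bound) (auto simp: norm_mult)
qed

definition gauss_fourier :: "real poly \<Rightarrow> real \<Rightarrow> complex" where
  "gauss_fourier p y = (CLINT x|lborel. complex_of_real (exp (- x\<^sup>2) * poly p x) * iexp (x * y))"

lemma integrable_gauss_fourier:
  "integrable lborel (\<lambda>x. complex_of_real (exp (- x\<^sup>2) * poly p x) * iexp (x * y))"
  using integrable_gauss_poly[of 1 p y] by simp

lemma gauss_fourier_sum:
  "gauss_fourier (\<Sum>k\<in>S. smult (c k) (q k)) y = (\<Sum>k\<in>S. complex_of_real (c k) * gauss_fourier (q k) y)"
proof -
  have "gauss_fourier (\<Sum>k\<in>S. smult (c k) (q k)) y = (CLINT x|lborel. \<Sum>k\<in>S.
      complex_of_real (c k) * (complex_of_real (exp (- x\<^sup>2) * poly (q k) x) * iexp (x * y)))"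
    unfolding gauss_fourier_def
    by (intro Bochner_Integration.integral_cong refl)
      (simp add: poly_sum sum_distrib_left sum_distrib_right mult_ac)
  also have "\<dots> = (\<Sum>k\<in>S. complex_of_real (c k) * gauss_fourier (q k) y)"
    unfolding gauss_fourier_def
    by (simp only: Bochner_Integration.integral_sum integrable_mult_right integrable_gauss_fourier
        integral_mult_right_zero)
  finally show ?thesis .
qed

text \<open>The characteristic function of the standard normal law, rescaled by
  \<open>sqrt 2\<close> because \<open>exp (- x\<^sup>2)\<close> belongs to variance 1/2.\<close>

lemma gauss_fourier_1: "gauss_fourier 1 y = complex_of_real (2 * pi * heat_profile y)"
proof -
  have "complex_of_real (exp (- ((y / sqrt 2)\<^sup>2) / 2)) = char std_normal_distribution (y / sqrt 2)"
    by (simp add: char_std_normal_distribution)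
  also have "\<dots> = (CLINT x|lborel. std_normal_density x *\<^sub>R iexp (y / sqrt 2 * x))"
    unfolding char_def by (subst integral_density) auto
  also have "\<dots> = \<bar>sqrt 2\<bar> *\<^sub>R (CLINT x|lborel.
      std_normal_density (0 + sqrt 2 * x) *\<^sub>R iexp (y / sqrt 2 * (0 + sqrt 2 * x)))"
    by (rule lborel_integral_real_affine) simp
  also have "\<dots> = \<bar>sqrt 2\<bar> *\<^sub>R (CLINT x|lborel. complex_of_real (1 / sqrt (2 * pi))
      * (complex_of_real (exp (- x\<^sup>2) * poly 1 x) * iexp (x * y)))"
    by (intro arg_cong2[of _ _ _ _ scaleR] refl Bochner_Integration.integral_cong)
      (simp add: std_normal_density_def power_mult_distrib scaleR_conv_of_real mult_ac)
  also have "\<dots> = complex_of_real (1 / sqrt pi) * gauss_fourier 1 y"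
  proof -
    have "\<bar>sqrt 2\<bar> *\<^sub>R (CLINT x|lborel. complex_of_real c * F x)
        = complex_of_real (sqrt 2 * c) * (CLINT x|lborel. F x)" for c and F :: "real \<Rightarrow> complex"
      by (simp add: scaleR_conv_of_real)
    moreover have "sqrt 2 * (1 / sqrt (2 * pi)) = 1 / sqrt pi" by (simp add: real_sqrt_mult)
    ultimately show ?thesis unfolding gauss_fourier_def by presburger
  qed
  finally have "gauss_fourier 1 y = complex_of_real (sqrt pi * exp (- (y\<^sup>2) / 4))"
    by (simp add: power_divide field_simps flip: of_real_mult)
  also have "sqrt pi * exp (- (y\<^sup>2) / 4) = 2 * pi * heat_profile y"
    unfolding heat_profile_def by (simp add: field_simps)
  finally show ?thesis .
qed

text \<open>This permits differentiation of a Fourier integral by integrating a second-order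
  remainder, with no limit taken under the integral.\<close>

lemma has_vector_derivative_quadratic_bound:
  fixes f :: "real \<Rightarrow> 'a::real_normed_vector"
  assumes "\<And>z. norm (f z - f y - (z - y) *\<^sub>R D) \<le> C * (z - y)\<^sup>2"
  shows "(f has_vector_derivative D) (at y)"
  unfolding has_vector_derivative_def
proof (rule has_derivativeI_sandwich[where e = 1 and H = "\<lambda>z. C * \<bar>z - y\<bar>"])
  show "bounded_linear (\<lambda>x. x *\<^sub>R D)" by (rule bounded_linear_scaleR_left)
  fix z assume "z \<noteq> y"
  then show "norm (f z - f y - (z - y) *\<^sub>R D) / norm (z - y) \<le> C * \<bar>z - y\<bar>"
    using assms[of z] by (simp add: divide_le_eq mult.assoc abs_mult_self_eq power2_eq_square)
next
  have "((\<lambda>z. C * \<bar>z - y\<bar>) \<longlongrightarrow> C * \<bar>y - y\<bar>) (at y)" by (intro tendsto_intros)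
  then show "((\<lambda>z. C * \<bar>z - y\<bar>) \<longlongrightarrow> 0) (at y)" by simp
qed auto

text \<open>The remainder of \<open>iexp\<close> is at most \<open>(x * (z - y))\<^sup>2\<close>,
  and the extra factor \<open>x\<^sup>2\<close> is integrable against the Gaussian.\<close>

lemma gauss_fourier_has_derivative:
  "(gauss_fourier p has_vector_derivative \<i> * gauss_fourier ([:0, 1:] * p) y) (at y)"
proof (rule has_vector_derivative_quadratic_bound)
  define C where "C = (LINT x|lborel. \<bar>exp (- x\<^sup>2) * poly p x * x\<^sup>2\<bar>)"
  have int: "integrable lborel (\<lambda>x. exp (- x\<^sup>2) * poly p x * x\<^sup>2)"
  proof -
    have "integrable lborel (\<lambda>x. norm (complex_of_real (exp (- x\<^sup>2) * poly ([:0, 0, 1:] * p) x) * iexp (x * 0)))"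
      by (rule integrable_norm[OF integrable_gauss_fourier])
    then have "integrable lborel (\<lambda>x. \<bar>exp (- x\<^sup>2) * poly p x * x\<^sup>2\<bar>)"
      by (rule Bochner_Integration.integrable_cong[THEN iffD1, OF refl, rotated])
        (simp add: norm_mult abs_mult power2_eq_square mult_ac)
    then show ?thesis by (rule Bochner_Integration.integrable_bound) (auto simp: abs_mult)
  qed
  fix z
  define g where "g = (\<lambda>q y x. complex_of_real (exp (- x\<^sup>2) * poly q x) * iexp (x * y))"
  have g: "integrable lborel (g q y)" for q y unfolding g_def by (rule integrable_gauss_fourier)
  have gf: "gauss_fourier q y = (CLINT x|lborel. g q y x)" for q y unfolding g_def gauss_fourier_def ..
  have "gauss_fourier p z - gauss_fourier p y - (z - y) *\<^sub>R (\<i> * gauss_fourier ([:0, 1:] * p) y)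
      = (CLINT x|lborel. g p z x - g p y x - (z - y) *\<^sub>R (\<i> * g ([:0, 1:] * p) y x))"
    unfolding gf using g by simp
  also have "norm \<dots> \<le> (LINT x|lborel. \<bar>exp (- x\<^sup>2) * poly p x * x\<^sup>2\<bar> * (z - y)\<^sup>2)"
  proof (rule Bochner_Integration.integral_norm_bound_integral)
    show "integrable lborel (\<lambda>x. g p z x - g p y x - (z - y) *\<^sub>R (\<i> * g ([:0, 1:] * p) y x))"
      using g by simp
    show "integrable lborel (\<lambda>x. \<bar>exp (- x\<^sup>2) * poly p x * x\<^sup>2\<bar> * (z - y)\<^sup>2)"
      using int by simp
    fix x
    define h where "h = x * (z - y)"
    have "g p z x - g p y x - (z - y) *\<^sub>R (\<i> * g ([:0, 1:] * p) y x)
        = complex_of_real (exp (- x\<^sup>2) * poly p x) * iexp (x * y) * (iexp h - (\<Sum>k\<le>1. (\<i> * h) ^ k / fact k))"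
    proof -
      have "iexp (x * z) = iexp (x * y) * iexp h"
        unfolding h_def by (simp add: algebra_simps flip: exp_add)
      then show ?thesis
        unfolding g_def h_def by (simp add: scaleR_conv_of_real algebra_simps)
    qed
    then have "norm (g p z x - g p y x - (z - y) *\<^sub>R (\<i> * g ([:0, 1:] * p) y x))
        = \<bar>exp (- x\<^sup>2) * poly p x\<bar> * norm (iexp h - (\<Sum>k\<le>1. (\<i> * h) ^ k / fact k))"
      by (simp only: norm_mult norm_of_real norm_exp_i_times mult_1_right)
    also have "\<dots> \<le> \<bar>exp (- x\<^sup>2) * poly p x\<bar> * (\<bar>h\<bar> ^ Suc 1 / fact (Suc 1))"
      by (intro mult_left_mono iexp_approx1) simp
    also have "\<dots> \<le> \<bar>exp (- x\<^sup>2) * poly p x\<bar> * h\<^sup>2"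
      by (intro mult_left_mono) (simp_all add: power2_eq_square abs_mult_self_eq)
    also have "\<dots> = \<bar>exp (- x\<^sup>2) * poly p x * x\<^sup>2\<bar> * (z - y)\<^sup>2"
      unfolding h_def by (simp add: abs_mult power_mult_distrib)
    finally show "norm (g p z x - g p y x - (z - y) *\<^sub>R (\<i> * g ([:0, 1:] * p) y x))
        \<le> \<bar>exp (- x\<^sup>2) * poly p x * x\<^sup>2\<bar> * (z - y)\<^sup>2" .
  qed
  also have "\<dots> = C * (z - y)\<^sup>2" unfolding C_def by simp
  finally show "norm (gauss_fourier p z - gauss_fourier p y - (z - y) *\<^sub>R (\<i> * gauss_fourier ([:0, 1:] * p) y))
      \<le> C * (z - y)\<^sup>2" .
qed

lemma higher_deriv_heat_profile:
  "complex_of_real (2 * pi * (deriv ^^ k) heat_profile y) = \<i> ^ k * gauss_fourier (monom 1 k) y"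
proof (induction k arbitrary: y)
  case 0
  then show ?case using gauss_fourier_1[of y] by (simp add: monom_0 one_pCons)
next
  case (Suc k)
  define f where "f = (deriv ^^ k) heat_profile"
  define D where "D = \<i> ^ Suc k * gauss_fourier (monom 1 (Suc k)) y"
  have "((\<lambda>y. \<i> ^ k * gauss_fourier (monom 1 k) y) has_vector_derivative
      \<i> ^ k * (\<i> * gauss_fourier ([:0, 1:] * monom 1 k) y)) (at y)"
    by (intro has_vector_derivative_mult_right gauss_fourier_has_derivative)
  then have D: "((\<lambda>y. complex_of_real (2 * pi * f y)) has_vector_derivative D) (at y)"
    unfolding D_def f_def Suc[symmetric] by (simp add: monom_Suc mult_ac)
  \<comment> \<open>\<open>deriv\<close> is a real derivative, the integral is complex: the real
    part yields \<open>deriv f y\<close>, and \<open>Im D\<close> vanishes as the derivative of the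
    constant 0.\<close>
  from bounded_linear.has_vector_derivative[OF bounded_linear_Re D]
  have "((\<lambda>y. 2 * pi * f y) has_real_derivative Re D) (at y)"
    by (simp add: has_real_derivative_iff_has_vector_derivative)
  then have "((\<lambda>y. 1 / (2 * pi) * (2 * pi * f y)) has_real_derivative 1 / (2 * pi) * Re D) (at y)"
    by (rule DERIV_cmult)
  then have "deriv f y = Re D / (2 * pi)" by (intro DERIV_imp_deriv) simp
  moreover have "Im D = 0"
  proof -
    have "((\<lambda>y. 0) has_vector_derivative Im D) (at y)"
      using bounded_linear.has_vector_derivative[OF bounded_linear_Im D] by simp
    then show ?thesis using has_vector_derivative_const vector_derivative_unique_at by blast
  qed
  ultimately show ?case
    unfolding D_def[symmetric] by (simp add: f_def complex_eq_iff)
qed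

text \<open>\<open>(- \<i>) ^ k\<close> undoes the \<open>\<i> ^ k\<close> of k-fold
  differentiation, so the operator becomes multiplication by \<open>p\<close> under the Fourier
  integral.\<close>

lemma poly_diff_op_heat_profile:
  "poly_diff_op p heat_profile y = gauss_fourier p y / complex_of_real (2 * pi)"
proof -
  have "(- \<i>) ^ k * complex_of_real ((deriv ^^ k) heat_profile y)
      = gauss_fourier (monom 1 k) y / complex_of_real (2 * pi)" for k
  proof -
    have "(- \<i>) ^ k * complex_of_real (2 * pi * (deriv ^^ k) heat_profile y) = gauss_fourier (monom 1 k) y"
      unfolding higher_deriv_heat_profile mult.assoc[symmetric] power_mult_distrib[symmetric] by simp
    then show ?thesis by (simp add: field_simps)
  qed
  then have "poly_diff_op p heat_profile y
      = (\<Sum>k\<le>degree p. complex_of_real (coeff p k) * gauss_fourier (monom 1 k) y) / complex_of_real (2 * pi)"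
    unfolding poly_diff_op_def by (simp add: mult.assoc sum_divide_distrib)
  also have "(\<Sum>k\<le>degree p. complex_of_real (coeff p k) * gauss_fourier (monom 1 k) y)
      = gauss_fourier (\<Sum>k\<le>degree p. smult (coeff p k) (monom 1 k)) y"
    by (rule gauss_fourier_sum[symmetric])
  also have "(\<Sum>k\<le>degree p. smult (coeff p k) (monom 1 k)) = p"
    by (simp add: smult_monom poly_as_sum_of_monoms)
  finally show ?thesis .
qed

text \<open>Puts the leading profile into the form of the others;
  \<open>(- \<i>) ^ (2 * J) = (- 1) ^ J\<close> cancels the sign of the monomial.\<close>

lemma profile_zero_eq:
  "profile_zero J y = poly_diff_op (monom ((- 1) ^ J) (2 * J)) heat_profile y"
proof -
  have deg: "degree (monom ((- 1 :: real) ^ J) (2 * J)) = 2 * J" by (simp add: degree_monom_eq)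
  have "poly_diff_op (monom ((- 1) ^ J) (2 * J)) heat_profile y
      = (\<Sum>k\<le>2 * J. if k = 2 * J then (- 1) ^ J * (- \<i>) ^ k * complex_of_real ((deriv ^^ k) heat_profile y) else 0)"
    unfolding poly_diff_op_def deg by (intro sum.cong refl) simp
  also have "\<dots> = profile_zero J y"
    by (simp add: profile_zero_def power_mult flip: power_mult_distrib)
  finally show ?thesis by simp
qed

section \<open>Parabolic scaling and the expansion as a single Fourier integral\<close>

lemma gauss_fourier_scale:
  assumes "0 < t"
  shows "complex_of_real (1 / sqrt t) * gauss_fourier p (x / sqrt t)
    = (CLINT \<theta>|lborel. complex_of_real (exp (- t * \<theta>\<^sup>2) * poly p (\<theta> * sqrt t)) * iexp (\<theta> * x))"
proof -
  have "gauss_fourier p (x / sqrt t) = \<bar>sqrt t\<bar> *\<^sub>R (CLINT \<theta>|lborel.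
      complex_of_real (exp (- (0 + sqrt t * \<theta>)\<^sup>2) * poly p (0 + sqrt t * \<theta>))
        * iexp ((0 + sqrt t * \<theta>) * (x / sqrt t)))"
    unfolding gauss_fourier_def using assms by (intro lborel_integral_real_affine) simp
  also have "\<dots> = complex_of_real (sqrt t)
      * (CLINT \<theta>|lborel. complex_of_real (exp (- t * \<theta>\<^sup>2) * poly p (\<theta> * sqrt t)) * iexp (\<theta> * x))"
    using assms by (simp add: power_mult_distrib scaleR_conv_of_real mult_ac)
  finally show ?thesis using assms by simp
qed

lemma integrable_gauss_scaled:
  assumes "0 < t"
  shows "integrable lborel (\<lambda>\<theta>. complex_of_real (exp (- t * \<theta>\<^sup>2) * poly p (\<theta> * sqrt t)) * iexp (\<theta> * x))"
proof -
  have "poly p (\<theta> * sqrt t) = poly (pcompose p [:0, sqrt t:]) \<theta>" for \<theta>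
    by (simp add: poly_pcompose)
  then show ?thesis using integrable_gauss_poly[OF assms] by presburger
qed

text \<open>Interchanging the finite sums collects powers of \<open>\<theta>\<^sup>2\<close>: the
  coefficient is 1 at order 0, vanishes strictly between 0 and \<open>N\<close>, and yields
  \<open>poly_R\<close> from \<open>N\<close> on.\<close>

lemma gauss_kernel_eq:
  assumes "1 \<le> N" "0 < t"
  shows "gauss_kernel N a J K t \<theta> = exp (- t * \<theta>\<^sup>2) * ((- 1) ^ J * \<theta> ^ (2 * J)
    + (\<Sum>n=N..K. poly (poly_R N a J n) (\<theta> * sqrt t) / t ^ (n + J)))"
proof -
  define E where "E = (\<lambda>n. \<Sum>m\<le>K. (t * \<theta>\<^sup>2) ^ m / fact m
      * fps_nth ((1 - coef_b_fps N a) ^ J * coef_b_fps N a ^ m) n)"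
  have "truncated_factor N a J K (t * \<theta>\<^sup>2) \<theta> = (\<Sum>n\<le>K. \<theta> ^ (2 * n) * E n)"
    unfolding truncated_factor_def E_def sum_distrib_left by (subst sum.swap) (simp add: mult_ac)
  also have "\<dots> = E 0 + (\<Sum>n=1..K. \<theta> ^ (2 * n) * E n)"
    by (simp add: atMost_atLeast0 sum.atLeast_Suc_atMost)
  also have "E 0 = 1" unfolding E_def by (rule sum_fps_nth_0[OF assms(1)])
  also have "(\<Sum>n=1..K. \<theta> ^ (2 * n) * E n) = (\<Sum>n=N..K. \<theta> ^ (2 * n) * E n)"
    unfolding E_def using assms(1) sum_fps_nth_eq_0[of N _ K]
    by (intro sum.mono_neutral_right) (auto simp: not_le)
  finally have "gauss_kernel N a J K t \<theta> = exp (- t * \<theta>\<^sup>2) * ((- 1) ^ J * \<theta> ^ (2 * J)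
      + (\<Sum>n=N..K. (- 1) ^ J * \<theta> ^ (2 * J) * \<theta> ^ (2 * n) * E n))"
    unfolding gauss_kernel_def by (simp add: distrib_left sum_distrib_left mult_ac)
  also have "(\<Sum>n=N..K. (- 1) ^ J * \<theta> ^ (2 * J) * \<theta> ^ (2 * n) * E n)
      = (\<Sum>n=N..K. poly (poly_R N a J n) (\<theta> * sqrt t) / t ^ (n + J))"
    unfolding E_def by (intro sum.cong refl poly_R_eq[symmetric]) (use assms in auto)
  finally show ?thesis .
qed

lemma profile_sum_eq:
  assumes "1 \<le> N" "0 < t"
  shows "complex_of_real (1 / (t ^ J * sqrt t)) * profile_zero J (x / sqrt t)
      + (\<Sum>n=N..K. complex_of_real (1 / (t ^ (n + J) * sqrt t)) * profile N a J n (x / sqrt t))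
    = (CLINT \<theta>|lborel. complex_of_real (gauss_kernel N a J K t \<theta>) * iexp (\<theta> * x)) / complex_of_real (2 * pi)"
    (is "?lhs = _")
    and "integrable lborel (\<lambda>\<theta>. complex_of_real (gauss_kernel N a J K t \<theta>) * iexp (\<theta> * x))"
proof -
  define g where "g = (\<lambda>p \<theta>. complex_of_real (exp (- t * \<theta>\<^sup>2) * poly p (\<theta> * sqrt t)) * iexp (\<theta> * x))"
  have g: "integrable lborel (g p)" for p unfolding g_def by (rule integrable_gauss_scaled[OF assms(2)])
  define q where "q = monom ((- 1 :: real) ^ J) (2 * J)"
  have single: "complex_of_real (1 / (t ^ n * sqrt t)) * poly_diff_op p heat_profile (x / sqrt t)
      = (CLINT \<theta>|lborel. complex_of_real (1 / t ^ n) * g p \<theta>) / complex_of_real (2 * pi)" for p n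
    unfolding g_def poly_diff_op_heat_profile
    using gauss_fourier_scale[OF assms(2), of p x, symmetric] by simp
  have q: "(- 1) ^ J * \<theta> ^ (2 * J) = poly q (\<theta> * sqrt t) / t ^ J" for \<theta>
    unfolding q_def using assms(2) by (simp add: poly_monom power_mult_distrib power_mult)
  have kernel: "complex_of_real (gauss_kernel N a J K t \<theta>) * iexp (\<theta> * x)
      = complex_of_real (1 / t ^ J) * g q \<theta>
        + (\<Sum>n=N..K. complex_of_real (1 / t ^ (n + J)) * g (poly_R N a J n) \<theta>)" for \<theta>
  proof -
    have "gauss_kernel N a J K t \<theta> = 1 / t ^ J * (exp (- t * \<theta>\<^sup>2) * poly q (\<theta> * sqrt t))
        + (\<Sum>n=N..K. 1 / t ^ (n + J) * (exp (- t * \<theta>\<^sup>2) * poly (poly_R N a J n) (\<theta> * sqrt t)))"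
      unfolding gauss_kernel_eq[OF assms] q distrib_left sum_distrib_left by (simp add: mult_ac)
    then show ?thesis
      unfolding g_def by (simp only: of_real_add of_real_sum of_real_mult distrib_right sum_distrib_right mult.assoc)
  qed
  show "integrable lborel (\<lambda>\<theta>. complex_of_real (gauss_kernel N a J K t \<theta>) * iexp (\<theta> * x))"
    unfolding kernel by (intro Bochner_Integration.integrable_add Bochner_Integration.integrable_sum integrable_mult_right g)
  have "?lhs = ((CLINT \<theta>|lborel. complex_of_real (1 / t ^ J) * g q \<theta>)
      + (\<Sum>n=N..K. CLINT \<theta>|lborel. complex_of_real (1 / t ^ (n + J)) * g (poly_R N a J n) \<theta>))
      / complex_of_real (2 * pi)"
    unfolding profile_zero_eq profile_def single q_def[symmetric] add_divide_distrib sum_divide_distrib ..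
  also have "\<dots> = (CLINT \<theta>|lborel. complex_of_real (gauss_kernel N a J K t \<theta>) * iexp (\<theta> * x))
      / complex_of_real (2 * pi)"
    unfolding kernel
    by (subst Bochner_Integration.integral_add)
      (simp_all only: Bochner_Integration.integral_sum Bochner_Integration.integrable_sum integrable_mult_right g)
  finally show "?lhs = (CLINT \<theta>|lborel. complex_of_real (gauss_kernel N a J K t \<theta>) * iexp (\<theta> * x))
      / complex_of_real (2 * pi)" .
qed

section \<open>The Green function\<close>

definition green_integrand :: "nat \<Rightarrow> (nat \<Rightarrow> real) \<Rightarrow> nat \<Rightarrow> int \<Rightarrow> real \<Rightarrow> real \<Rightarrow> complex" where
  "green_integrand N a J x t \<theta> =
     complex_of_real (symbol_kernel N a J t \<theta>) * iexp (\<theta> * real_of_int x)"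

text \<open>\<open>J\<close> counts the time derivatives taken under the integral.\<close>

definition green_integral :: "nat \<Rightarrow> (nat \<Rightarrow> real) \<Rightarrow> nat \<Rightarrow> int \<Rightarrow> real \<Rightarrow> complex" where
  "green_integral N a J x t =
     integral {- pi..pi} (green_integrand N a J x t) / complex_of_real (2 * pi)"

lemma continuous_on_symbol_kernel [continuous_intros]:
  fixes f g :: "'a::t2_space \<Rightarrow> real"
  assumes "continuous_on S f" "continuous_on S g"
  shows "continuous_on S (\<lambda>z. symbol_kernel N a J (f z) (g z))"
  unfolding symbol_kernel_def symbol_def using assms by (intro continuous_intros)

lemma continuous_on_green_integrand: "continuous_on S (green_integrand N a J x t)"
  unfolding green_integrand_def by (intro continuous_intros)

lemma green_integrand_integrable: "green_integrand N a J x t integrable_on {- pi..pi}"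
  by (intro integrable_continuous_real continuous_on_green_integrand)

lemma green_integral_has_derivative:
  "(green_integral N a J x has_vector_derivative green_integral N a (Suc J) x t) (at t)"
proof -
  have "((\<lambda>t. integral (cbox (- pi) pi) (green_integrand N a J x t)) has_vector_derivative
      integral (cbox (- pi) pi) (green_integrand N a (Suc J) x t)) (at t within UNIV)"
  proof (rule leibniz_rule_vector_derivative)
    show "((\<lambda>t. green_integrand N a J x t \<theta>) has_vector_derivative green_integrand N a (Suc J) x t \<theta>)
        (at t within UNIV)" for t \<theta>
    proof -
      have "((\<lambda>t. symbol_kernel N a J t \<theta>) has_real_derivative symbol_kernel N a (Suc J) t \<theta>) (at t)"
        unfolding symbol_kernel_def by (auto intro!: derivative_eq_intros)
      then have "((\<lambda>t. symbol_kernel N a J t \<theta>) has_vector_derivative symbol_kernel N a (Suc J) t \<theta>) (at t)"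
        by (simp add: has_real_derivative_iff_has_vector_derivative)
      from bounded_linear.has_vector_derivative[OF bounded_linear_of_real this]
      show ?thesis unfolding green_integrand_def
        by (intro has_vector_derivative_mult_left) simp
    qed
    show "green_integrand N a J x t integrable_on cbox (- pi) pi" for t
      using green_integrand_integrable by simp
    show "continuous_on (UNIV \<times> cbox (- pi) pi) (\<lambda>(t, \<theta>). green_integrand N a (Suc J) x t \<theta>)"
      unfolding green_integrand_def split_beta by (intro continuous_intros)
  qed auto
  then show ?thesis
    unfolding green_integral_def[abs_def] divide_inverse
    by (intro has_vector_derivative_mult_left) simp
qed

section \<open>The Fourier integral solves the lattice heat equation\<close>

lemma discrete_laplacian_iexp:
  "discrete_laplacian N a (\<lambda>y. iexp (\<theta> * real_of_int y)) x
    = complex_of_real (- symbol N a \<theta>) * iexp (\<theta> * real_of_int x)"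
proof -
  have "iexp (\<theta> * real_of_int (x - int \<nu>)) - 2 * iexp (\<theta> * real_of_int x) + iexp (\<theta> * real_of_int (x + int \<nu>))
      = complex_of_real (- 2 * (1 - cos (real \<nu> * \<theta>))) * iexp (\<theta> * real_of_int x)" for \<nu>
  proof -
    define s where "s = \<theta> * real_of_int x"
    define v where "v = real \<nu> * \<theta>"
    have "\<theta> * real_of_int (x - int \<nu>) = s - v" "\<theta> * real_of_int (x + int \<nu>) = s + v"
      unfolding s_def v_def by (simp_all add: algebra_simps)
    moreover have "cis (s - v) - 2 * cis s + cis (s + v) = complex_of_real (- 2 * (1 - cos v)) * cis s"
      by (simp add: complex_eq_iff cos_add cos_diff sin_add sin_diff algebra_simps)
    ultimately show ?thesis
      unfolding s_def[symmetric] v_def[symmetric] by (simp only: cis_conv_exp)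
  qed
  then have "discrete_laplacian N a (\<lambda>y. iexp (\<theta> * real_of_int y)) x
      = (\<Sum>\<nu>=1..N. complex_of_real (a \<nu> * (- 2 * (1 - cos (real \<nu> * \<theta>)))) * iexp (\<theta> * real_of_int x))"
    unfolding discrete_laplacian_def by (simp only: of_real_mult mult.assoc)
  also have "\<dots> = complex_of_real (- symbol N a \<theta>) * iexp (\<theta> * real_of_int x)"
  proof -
    have "(\<Sum>\<nu>=1..N. a \<nu> * (- 2 * (1 - cos (real \<nu> * \<theta>)))) = - symbol N a \<theta>"
      unfolding symbol_def sum_distrib_left sum_negf[symmetric]
      by (intro sum.cong refl) (simp add: algebra_simps)
    then show ?thesis unfolding sum_distrib_right[symmetric] of_real_sum[symmetric] by simp
  qed
  finally show ?thesis .
qed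

lemma discrete_laplacian_cmult:
  "discrete_laplacian N a (\<lambda>y. c * w y) x = c * discrete_laplacian N a w x"
  unfolding discrete_laplacian_def sum_distrib_left
  by (intro sum.cong refl) (simp add: algebra_simps)

lemma discrete_laplacian_diff:
  "discrete_laplacian N a (\<lambda>y. v y - w y) x = discrete_laplacian N a v x - discrete_laplacian N a w x"
  unfolding discrete_laplacian_def sum_subtractf[symmetric]
  by (intro sum.cong refl) (simp add: algebra_simps)

text \<open>The Laplacian multiplies the integrand by \<open>- symbol N a \<theta>\<close>, exactly
  as the time derivative does; both raise \<open>J\<close> by one.\<close>

lemma discrete_laplacian_green_integral:
  "discrete_laplacian N a (\<lambda>y. green_integral N a J y t) x = green_integral N a (Suc J) x t"
proof -
  have "((\<lambda>\<theta>. discrete_laplacian N a (\<lambda>y. green_integrand N a J y t \<theta>) x) has_integral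
      discrete_laplacian N a (\<lambda>y. integral {- pi..pi} (green_integrand N a J y t)) x) {- pi..pi}"
    unfolding discrete_laplacian_def
    by (intro has_integral_sum has_integral_mult_right has_integral_add has_integral_diff
        integrable_integral green_integrand_integrable) simp
  moreover have "discrete_laplacian N a (\<lambda>y. green_integrand N a J y t \<theta>) x = green_integrand N a (Suc J) x t \<theta>" for \<theta>
    unfolding green_integrand_def discrete_laplacian_cmult discrete_laplacian_iexp
    by (simp add: symbol_kernel_def mult_ac)
  ultimately have "discrete_laplacian N a (\<lambda>y. integral {- pi..pi} (green_integrand N a J y t)) x
      = integral {- pi..pi} (green_integrand N a (Suc J) x t)"
    by (simp add: integral_unique)
  then show ?thesis
    unfolding green_integral_def divide_inverse mult.commute[of _ "inverse _"] discrete_laplacian_cmult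
    by simp
qed

lemma bounded_green_integral: "bounded (range (\<lambda>x. green_integral N a J x t))"
proof -
  define B where "B = integral {- pi..pi} (\<lambda>\<theta>. \<bar>symbol_kernel N a J t \<theta>\<bar>)"
  have "norm (integral {- pi..pi} (green_integrand N a J x t)) \<le> B" for x
    unfolding B_def
    by (intro Henstock_Kurzweil_Integration.integral_norm_bound_integral green_integrand_integrable
        integrable_continuous_real continuous_intros) (simp add: green_integrand_def norm_mult)
  then have "norm (green_integral N a J x t) \<le> B / (2 * pi)" for x
    unfolding green_integral_def by (simp add: norm_divide divide_right_mono)
  then show ?thesis unfolding bounded_iff by blast
qed

lemma green_integral_initial: "green_integral N a 0 x 0 = (if x = 0 then 1 else 0)"
proof (cases "x = 0")
  case True
  then show ?thesis
    by (simp add: green_integral_def green_integrand_def[abs_def] symbol_kernel_def scaleR_conv_of_real)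
next
  case False
  \<comment> \<open>An explicit antiderivative, with equal values at both ends since
    \<open>x\<close> is an integer.\<close>
  define F where "F = (\<lambda>\<theta>. cis (\<theta> * real_of_int x) / (\<i> * of_int x))"
  have "(green_integrand N a 0 x 0 has_integral F pi - F (- pi)) {- pi..pi}"
  proof (rule fundamental_theorem_of_calculus)
    fix \<theta> :: real
    have "((\<lambda>\<theta>. cis (\<theta> * real_of_int x)) has_vector_derivative
        real_of_int x *\<^sub>R (\<i> * cis (\<theta> * real_of_int x))) (at \<theta> within {- pi..pi})"
      by (rule has_vector_derivative_eq_rhs, unfold has_vector_derivative_complex_iff)
        (auto intro!: derivative_eq_intros)
    from has_vector_derivative_mult_left[OF this, of "inverse (\<i> * of_int x)"]
    have "(F has_vector_derivative real_of_int x *\<^sub>R (\<i> * cis (\<theta> * real_of_int x)) * inverse (\<i> * of_int x))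
        (at \<theta> within {- pi..pi})"
      unfolding F_def divide_inverse .
    also have "real_of_int x *\<^sub>R (\<i> * cis (\<theta> * real_of_int x)) * inverse (\<i> * of_int x)
        = cis (\<theta> * real_of_int x)"
      using False by (simp add: scaleR_conv_of_real field_simps)
    also have "\<dots> = green_integrand N a 0 x 0 \<theta>"
      by (simp add: green_integrand_def symbol_kernel_def cis_conv_exp)
    finally show "(F has_vector_derivative green_integrand N a 0 x 0 \<theta>) (at \<theta> within {- pi..pi})" .
  qed simp
  moreover have "cis (pi * real_of_int x) = cis (- pi * real_of_int x)"
    by (simp add: complex_eq_iff)
  ultimately have "integral {- pi..pi} (green_integrand N a 0 x 0) = 0"
    unfolding F_def by (simp add: integral_unique)
  then show ?thesis using False unfolding green_integral_def by simp
qed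

section \<open>Identification of the Green function\<close>

lemma first_discrete_green_derivative:
  assumes "first_discrete_green N a u" "0 \<le> t"
  shows "(u x has_vector_derivative discrete_laplacian N a (\<lambda>y. u y t) x) (at t within {0..})"
proof -
  have C1: "C1_on_halfline (u x)" for x
    using assms(1) unfolding first_discrete_green_def by blast
  have ode: "dt (u x) t = discrete_laplacian N a (\<lambda>y. u y t) x" if "0 < t" for t
    using assms(1) that unfolding first_discrete_green_def by (metis eq_iff_diff_eq_0)
  have cont: "continuous_on {0..} (u x)" for x
    using C1[of x] unfolding C1_on_halfline_def continuous_on_eq_continuous_within
    by (metis atLeast_iff has_vector_derivative_continuous)
  obtain f' where f': "\<And>t. 0 \<le> t \<Longrightarrow> (u x has_vector_derivative f' t) (at t within {0..})"
    "continuous_on {0..} f'"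
    using C1[of x] unfolding C1_on_halfline_def by blast
  have "f' s - discrete_laplacian N a (\<lambda>y. u y s) x = 0" if "s \<in> {0<..}" for s
  proof -
    have "(u x has_vector_derivative f' s) (at s)"
      using f'(1)[of s] that at_within_interior[of s "{0..}"] by simp
    then show ?thesis using ode[of s] that by (simp add: vector_derivative_at)
  qed
  \<comment> \<open>The equation is given for positive times; continuity of \<open>f'\<close>
    carries it to time 0, where the one-sided derivative is needed for gluing with the zero
    function.\<close>
  then have "f' t - discrete_laplacian N a (\<lambda>y. u y t) x = 0"
  proof (rule continuous_constant_on_closure[rotated])
    show "t \<in> closure {0<..}" using assms(2) by simp
    show "continuous_on (closure {0<..}) (\<lambda>s. f' s - discrete_laplacian N a (\<lambda>y. u y s) x)"
      unfolding discrete_laplacian_def using f'(2) cont by (simp, intro continuous_intros)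
  qed
  then show ?thesis using f'(1)[OF assms(2)] by simp
qed

lemma first_discrete_green_eq_integral:
  assumes "first_discrete_green N a u" "0 \<le> t"
  shows "u x t = green_integral N a 0 x t"
proof -
  define d where "d = (\<lambda>x t. u x t - green_integral N a 0 x t)"
  \<comment> \<open>Extension by 0 to negative times. It is differentiable across 0, since the
    difference and hence its Laplacian vanish there. The result solves the equation on the whole
    line, as time reversal and two-sided neighbourhoods demand.\<close>
  define w where "w = (\<lambda>x t. if t \<in> {0..} then d x t else 0)"
  have d0: "d x 0 = 0" for x
    using assms(1) unfolding d_def first_discrete_green_def green_integral_initial by auto
  have d': "(d x has_vector_derivative discrete_laplacian N a (\<lambda>y. d y t) x) (at t within {0..})"
    if "0 \<le> t" for x t
    unfolding d_def discrete_laplacian_diff discrete_laplacian_green_integral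
    by (intro has_vector_derivative_diff first_discrete_green_derivative[OF assms(1) that]
        has_vector_derivative_at_within[OF green_integral_has_derivative])
  have lap0: "discrete_laplacian N a (\<lambda>y. 0) x = 0" for x unfolding discrete_laplacian_def by simp
  have "lattice_heat_solution N a w"
    unfolding lattice_heat_solution_def
  proof (intro allI)
    fix x t
    have "(w x has_vector_derivative (if t \<in> {0..} then discrete_laplacian N a (\<lambda>y. d y t) x else 0))
        (at t within UNIV)"
      unfolding w_def
    proof (rule has_vector_derivative_If_within_closures[where T = "{..0}"])
      show "(d x has_vector_derivative discrete_laplacian N a (\<lambda>y. d y t) x)
          (at t within {0..} \<union> (closure {0..} \<inter> closure {..0}))"
        if "t \<in> {0..} \<union> (closure {0..} \<inter> closure {..0})"
        using d'[of t x] that by (auto simp: insert_absorb)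
    qed (auto simp: d0 lap0)
    then show "(w x has_vector_derivative discrete_laplacian N a (\<lambda>y. w y t) x) (at t)"
      unfolding w_def by (auto simp: lap0 split: if_splits)
  qed
  moreover have "bounded (range (\<lambda>x. w x t))" for t
  proof (cases "0 \<le> t")
    case True
    have "rapidly_decreasing (\<lambda>x. u x t)"
      using assms(1) True unfolding first_discrete_green_def by blast
    then obtain C where "\<forall>x. real_of_int \<bar>x\<bar> ^ 0 * norm (u x t) \<le> C"
      unfolding rapidly_decreasing_def by blast
    then have "bounded (range (\<lambda>x. u x t))" unfolding bounded_iff by auto
    from bounded_minus_comp[OF this bounded_green_integral] show ?thesis
      using True unfolding w_def d_def by simp
  qed (simp add: w_def)
  ultimately have "w x t = 0"
    by (rule lattice_heat_solution_unique) (use assms(2) in \<open>simp_all add: w_def d0\<close>)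
  then show ?thesis using assms(2) unfolding w_def d_def by simp
qed

text \<open>Derivatives are transferred on the open half-line: \<open>u\<close> is unconstrained at
  negative times, so agreement with the integral is only available near each positive time.\<close>

lemma first_discrete_green_higher_derivative:
  assumes "first_discrete_green N a u" "0 < t"
  shows "(dt ^^ j) (u x) t = green_integral N a j x t"
    and "((dt ^^ j) (u x) has_vector_derivative green_integral N a (Suc j) x t) (at t)"
proof -
  have *: "(dt ^^ j) (u x) t = green_integral N a j x t
      \<and> ((dt ^^ j) (u x) has_vector_derivative green_integral N a (Suc j) x t) (at t)"
    if "0 < t" for t
    using that
  proof (induction j arbitrary: t)
    case 0
    then show ?case
      using first_discrete_green_eq_integral[OF assms(1)]
      by (auto intro!: has_vector_derivative_transform_within_open[OF green_integral_has_derivative, of "{0<..}"])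
  next
    case (Suc j)
    have eq: "(dt ^^ Suc j) (u x) s = green_integral N a (Suc j) x s" if "0 < s" for s
      using Suc.IH[OF that] by (simp add: vector_derivative_at)
    then show ?case using Suc.prems
      by (intro conjI has_vector_derivative_transform_within_open[OF green_integral_has_derivative, of "{0<..}"])
        (simp_all del: funpow.simps)
  qed
  show "(dt ^^ j) (u x) t = green_integral N a j x t"
    "((dt ^^ j) (u x) has_vector_derivative green_integral N a (Suc j) x t) (at t)"
    using *[OF assms(2)] by auto
qed

section \<open>Remainder estimate and conclusion\<close>

lemma gauss_moment_scale:
  assumes "0 < t" "0 < \<kappa>"
  shows "(LINT \<theta>|lborel. exp (- \<kappa> * (t * \<theta>\<^sup>2)) * \<theta> ^ (2 * k))
      = (LINT x|lborel. exp (- \<kappa> * x\<^sup>2) * x ^ (2 * k)) / (t ^ k * sqrt t)"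
    and "integrable lborel (\<lambda>\<theta>. exp (- \<kappa> * (t * \<theta>\<^sup>2)) * \<theta> ^ (2 * k))"
proof -
  have pow: "(0 + sqrt t * \<theta>) ^ (2 * k) = t ^ k * \<theta> ^ (2 * k)" for \<theta>
    using assms(1) by (simp add: power_mult power_mult_distrib)
  have sq: "(0 + sqrt t * \<theta>)\<^sup>2 = t * \<theta>\<^sup>2" for \<theta>
    using assms(1) by (simp add: power_mult_distrib)
  have "(LINT x|lborel. exp (- \<kappa> * x\<^sup>2) * x ^ (2 * k))
      = \<bar>sqrt t\<bar> *\<^sub>R (LINT \<theta>|lborel. exp (- \<kappa> * (0 + sqrt t * \<theta>)\<^sup>2) * (0 + sqrt t * \<theta>) ^ (2 * k))"
    using assms by (intro lborel_integral_real_affine) simp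
  also have "\<dots> = sqrt t * (LINT \<theta>|lborel. t ^ k * (exp (- \<kappa> * (t * \<theta>\<^sup>2)) * \<theta> ^ (2 * k)))"
    using assms(1) unfolding pow sq by (simp add: mult.left_commute)
  finally show "(LINT \<theta>|lborel. exp (- \<kappa> * (t * \<theta>\<^sup>2)) * \<theta> ^ (2 * k))
      = (LINT x|lborel. exp (- \<kappa> * x\<^sup>2) * x ^ (2 * k)) / (t ^ k * sqrt t)"
    using assms by simp
  show "integrable lborel (\<lambda>\<theta>. exp (- \<kappa> * (t * \<theta>\<^sup>2)) * \<theta> ^ (2 * k))"
    using integrable_gauss_moment[of "\<kappa> * t" "2 * k"] assms by (simp add: mult_ac)
qed

lemma green_integral_expansion:
  assumes "1 \<le> N" "fd_coeffs N a"
  obtains R where "0 \<le> R" "\<And>x t. 0 < t \<Longrightarrow>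
    norm (green_integral N a J x t
      - (complex_of_real (1 / (t ^ J * sqrt t)) * profile_zero J (real_of_int x / sqrt t)
        + (\<Sum>n=N..K. complex_of_real (1 / (t ^ (n + J) * sqrt t))
            * profile N a J n (real_of_int x / sqrt t))))
      \<le> R / (t ^ (J + K + 1) * sqrt t)"
proof -
  obtain C \<kappa> where C: "0 \<le> C" "0 < \<kappa>" "\<And>t \<theta>. 0 \<le> t \<Longrightarrow>
    \<bar>indicator {- pi..pi} \<theta> * symbol_kernel N a J t \<theta> - gauss_kernel N a J K t \<theta>\<bar>
      \<le> C * (exp (- \<kappa> * (t * \<theta>\<^sup>2)) * \<theta> ^ (2 * (J + K + 1)))"
    using kernel_approximation[OF assms] by blast
  define M where "M = (LINT x|lborel. exp (- \<kappa> * x\<^sup>2) * x ^ (2 * (J + K + 1)))"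
  have M: "0 \<le> M" unfolding M_def
    by (intro Bochner_Integration.integral_nonneg mult_nonneg_nonneg zero_le_even_power) auto
  have "norm (green_integral N a J x t
      - (complex_of_real (1 / (t ^ J * sqrt t)) * profile_zero J (real_of_int x / sqrt t)
        + (\<Sum>n=N..K. complex_of_real (1 / (t ^ (n + J) * sqrt t))
            * profile N a J n (real_of_int x / sqrt t))))
      \<le> (C * M / (2 * pi)) / (t ^ (J + K + 1) * sqrt t)" if t: "0 < t" for x t
  proof -
    \<comment> \<open>Extending the integrand by zero puts both integrals on the whole line, where
      the pointwise kernel estimate applies.\<close>
    define f where "f = (\<lambda>\<theta>. indicator {- pi..pi} \<theta> *\<^sub>R green_integrand N a J x t \<theta>)"
    define g where "g = (\<lambda>\<theta>. complex_of_real (gauss_kernel N a J K t \<theta>) * iexp (\<theta> * real_of_int x))"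
    have g: "integrable lborel g" unfolding g_def by (rule profile_sum_eq(2)[OF assms(1) t])
    have set_int: "set_integrable lborel {- pi..pi} (green_integrand N a J x t)"
      by (intro borel_integrable_atLeastAtMost' continuous_on_green_integrand)
    then have f: "integrable lborel f" unfolding f_def set_integrable_def .
    have "green_integral N a J x t = integral\<^sup>L lborel f / complex_of_real (2 * pi)"
      using set_borel_integral_eq_integral(2)[OF set_int]
      unfolding green_integral_def f_def set_lebesgue_integral_def by simp
    then have eq: "green_integral N a J x t
        - (complex_of_real (1 / (t ^ J * sqrt t)) * profile_zero J (real_of_int x / sqrt t)
          + (\<Sum>n=N..K. complex_of_real (1 / (t ^ (n + J) * sqrt t))
              * profile N a J n (real_of_int x / sqrt t)))
        = (CLINT \<theta>|lborel. f \<theta> - g \<theta>) / complex_of_real (2 * pi)"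
      unfolding profile_sum_eq(1)[OF assms(1) t] g_def[symmetric]
      by (simp add: Bochner_Integration.integral_diff[OF f g] diff_divide_distrib)
    have "norm (CLINT \<theta>|lborel. f \<theta> - g \<theta>)
        \<le> (LINT \<theta>|lborel. C * (exp (- \<kappa> * (t * \<theta>\<^sup>2)) * \<theta> ^ (2 * (J + K + 1))))"
    proof (rule Bochner_Integration.integral_norm_bound_integral)
      show "integrable lborel (\<lambda>\<theta>. f \<theta> - g \<theta>)" using f g by simp
      show "integrable lborel (\<lambda>\<theta>. C * (exp (- \<kappa> * (t * \<theta>\<^sup>2)) * \<theta> ^ (2 * (J + K + 1))))"
        by (intro integrable_mult_right gauss_moment_scale(2) t C(2))
      fix \<theta>
      have "f \<theta> - g \<theta> = complex_of_real
          (indicator {- pi..pi} \<theta> * symbol_kernel N a J t \<theta> - gauss_kernel N a J K t \<theta>)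
            * iexp (\<theta> * real_of_int x)"
        unfolding f_def g_def green_integrand_def
        by (simp only: scaleR_conv_of_real of_real_diff of_real_mult left_diff_distrib mult.assoc)
      then show "norm (f \<theta> - g \<theta>) \<le> C * (exp (- \<kappa> * (t * \<theta>\<^sup>2)) * \<theta> ^ (2 * (J + K + 1)))"
        using C(3)[of t \<theta>] t by (simp only: norm_mult norm_of_real norm_exp_i_times mult_1_right less_imp_le)
    qed
    also have "(LINT \<theta>|lborel. C * (exp (- \<kappa> * (t * \<theta>\<^sup>2)) * \<theta> ^ (2 * (J + K + 1))))
        = C * M / (t ^ (J + K + 1) * sqrt t)"
      unfolding integral_mult_right_zero gauss_moment_scale(1)[OF t C(2)] M_def by simp
    finally have "norm (CLINT \<theta>|lborel. f \<theta> - g \<theta>) / (2 * pi)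
        \<le> C * M / (t ^ (J + K + 1) * sqrt t) / (2 * pi)"
      by (rule divide_right_mono) simp
    then show ?thesis unfolding eq norm_divide by (simp add: mult.commute)
  qed
  then show ?thesis using that[of "C * M / (2 * pi)"] C(1) M by simp
qed

theorem theorem6p1:
  fixes N J K1 :: nat
    and a :: "nat \<Rightarrow> real"
    and u :: "int \<Rightarrow> real \<Rightarrow> complex"
  assumes "N \<ge> 1"
    and "fd_coeffs N a"
    and "first_discrete_green N a u"
    and "K1 \<ge> N"
  shows "\<exists>r :: int \<Rightarrow> real \<Rightarrow> complex. \<forall>t0>0. \<exists>R\<ge>0. \<forall>x. \<forall>t\<ge>t0.
    (\<forall>j<J. (dt ^^ j) (u x) differentiable (at t)) \<and>
    (dt ^^ J) (u x) t =
      complex_of_real (1 / (t ^ J * sqrt t)) * profile_zero J (real_of_int x / sqrt t)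
      + (\<Sum>n=N..K1. complex_of_real (1 / (t ^ (n + J) * sqrt t)) *
            profile N a J n (real_of_int x / sqrt t))
      + r x t \<and>
    norm (r x t) \<le> R / (t ^ (J + K1 + 1) * sqrt t)"
proof -
  define e where "e = (\<lambda>x t. complex_of_real (1 / (t ^ J * sqrt t)) * profile_zero J (real_of_int x / sqrt t)
      + (\<Sum>n=N..K1. complex_of_real (1 / (t ^ (n + J) * sqrt t)) *
            profile N a J n (real_of_int x / sqrt t)))"
  define r where "r = (\<lambda>x t. (dt ^^ J) (u x) t - e x t)"
  obtain R where R: "0 \<le> R" "\<And>x t. 0 < t \<Longrightarrow>
      norm (green_integral N a J x t - e x t) \<le> R / (t ^ (J + K1 + 1) * sqrt t)"
    using green_integral_expansion[OF assms(1,2), of J K1] unfolding e_def by blast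
  \<comment> \<open>\<open>vector_derivative\<close> is defined by choice and has a value even where
    no derivative exists; differentiability at the lower orders certifies that the iterated
    \<open>dt\<close> is the genuine derivative of order \<open>J\<close>.\<close>
  have "(\<forall>j<J. (dt ^^ j) (u x) differentiable (at t)) \<and> (dt ^^ J) (u x) t = e x t + r x t
      \<and> norm (r x t) \<le> R / (t ^ (J + K1 + 1) * sqrt t)" if "0 < t" for x t
    using first_discrete_green_higher_derivative[OF assms(3) that, of _ x] R(2)[OF that, of x]
    unfolding r_def by (auto intro: differentiableI_vector)
  then show ?thesis
    unfolding e_def using R(1) by (intro exI[of _ r] allI impI exI[of _ R] conjI) auto
qed

end
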